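(* Let $D=\{1,\dots,d\}$, $U=\{j\in D:\alpha_j\ge1\}$, and for $(x_1,\dots,x_d)\in\mathbb R_+^d$ let $$V(x_1,\dots,x_d)=G_U^{\,\theta^{\mathbf X}_U(1/x_1,\dots,1/x_d)_U}(x_1,\dots,x_d)_U\;H_{D-U}(x_1^{\alpha_1},\dots,x_d^{\alpha_d})_{D-U}$$ and $$\widehat V(x_1,\dots,x_d)=G_U(x_1,\dots,x_d)_U\;H_{D-U}(x_1^{\alpha_1},\dots,x_d^{\alpha_d})_{D-U}$$ be the multivariate extreme value distributions associated with the pMAX process $\{\mathbf Y_n\}_{n\ge1}$ built from $\{\mathbf{X}_n\}_{n\ge1}$, $\{\mathbf{Z}_n\}_{n\ge1}$ and $\boldsymbol\alpha=(\alpha_1,\dots,\alpha_d)$. Then the extremal coefficients of $\widehat V$ and $V$ are given by $$\epsilon_{\widehat V}=\epsilon_{G_U}+\epsilon_{H_{D-U}}$$ and $$\epsilon_V=\theta^{\mathbf X}_U\Bigl(\tfrac1{\theta_1},\dots,\tfrac1{\theta_d}\Bigr)_U\Bigl(-\log C_{G_U}\bigl(e^{-1/\theta_1},\dots,e^{-1/\theta_d}\bigr)_U\Bigr)+\epsilon_{H_{D-U}}.$$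
   Context: Notation: $a\vee b=\max(a,b)$; operations and inequalities on vectors are componentwise. For $A\subset D$, $(x_1,\dots,x_d)_A$ is the sub-vector of $(x_1,\dots,x_d)$ with indexes in $A$, and for a distribution function $F$, $F_A$ is the marginal distribution function of $F$ for the sub-vector with indexes in $A$. $C_F$ denotes the copula of $F$. Convention: if $U=\emptyset$ or $D-U=\emptyset$, the (additive) quantities involving the respective sub-distributions are taken to be zero (and the corresponding factor in $V$, $\widehat V$ is absent). pMAX setting: $\{\mathbf{X}_n=(X_{n,1},\dots,X_{n,d})\}_{n\ge1}$ is a stationary sequence with multivariate extremal index $\theta^{\mathbf X}(\tau_1,\dots,\tau_d)$, with common distribution function $F_{\mathbf X}$ having unit Fréchet marginals $\exp(-1/x)$, $x>0$, and in the domain of attraction of $G$, i.e. $C_{F_{\mathbf X}}^n(u_1^{1/n},\dots,u_d^{1/n})\to C_G(u_1,\dots,u_d)$. $\{\mathbf{Z}_n\}_{n\ge1}$ is an i.i.d. sequence of $d$-dimensional random vectors, independent of $\{\mathbf X_n\}_{n\ge 1}$, with common distribution function $F_{\mathbf Z}$ having unit Fréchet marginals and in the domain of attraction of $H$, i.e. $C_{F_{\mathbf Z}}^n(u_1^{1/n},\dots,u_d^{1/n})\to C_H(u_1,\dots,u_d)$. $G$ and $H$ are multivariate extreme value (MEV) distributions, with unit Fréchet marginals. $\boldsymbol\alpha$ is a vector of positive real constants, and $\mathbf{Y}_n=(Y_{n,1},\dots,Y_{n,d})$ with $Y_{n,j}=X_{n,j}\vee Z_{n,j}^{1/\alpha_j}$.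 Multivariate extremal index: a stationary sequence $\{\mathbf W_n\}_{n\ge1}$ has extremal index $\theta(\boldsymbol\tau)\in[0,1]$ if for each $\boldsymbol\tau\in\mathbb R_+^d$ there exist levels $\mathbf u_n^{(\boldsymbol\tau)}=(u_{n,j}^{(\tau_j)})_j$ with $n(1-F_{W_{n,j}}(u_{n,j}^{(\tau_j)}))\to\tau_j$ for each $j$, $P(\widehat{\mathbf M}_n\le\mathbf u_n^{(\boldsymbol\tau)})\to\gamma(\boldsymbol\tau)$ and $P(\mathbf M_n\le\mathbf u_n^{(\boldsymbol\tau)})\to\gamma(\boldsymbol\tau)^{\theta(\boldsymbol\tau)}$, where $\mathbf M_n$ is the vector of componentwise maxima of $\mathbf W_1,\dots,\mathbf W_n$ and $\widehat{\mathbf M}_n$ that of $n$ i.i.d. vectors with the same common distribution. It satisfies $\theta(c\tau_1,\dots,c\tau_d)=\theta(\tau_1,\dots,\tau_d)$ for all $c>0$. Further, $\theta^{\mathbf X}_U(\tau_1,\dots,\tau_d)_U=\lim_{\tau_j\downarrow0,\,j\in D-U}\theta^{\mathbf X}(\tau_1,\dots,\tau_d)$, and $\theta_j=\lim_{\tau_i\to0,\,i\ne j}\theta^{\mathbf X}(\tau_1,\dots,\tau_d)$ is the (univariate) extremal index of $\{X_{n,j}\}_{n\ge1}$, taken to be positive for $j\in U$ so that $1/\theta_j$ makes sense. Extremal coefficient: the extremal coefficient of a MEV distribution $F$ is the constant $\epsilon_F$ such that $C_F(u,\dots,u)=u^{\epsilon_F}$ for $u\in[0,1]$. (For MEV distributions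 with unit Fréchet marginals, such as $G_U$ and $H_{D-U}$, this is $\epsilon_F=-\log F(1,\dots,1)$.) *)

theory Defs
  imports "HOL-Probability.Probability"
begin

text \<open>
  The index set D is the whole finite type \<open>'d\<close>. A function of the sub-vector of \<open>x\<close> with indexes
  in \<open>I\<close> is a function of \<open>x :: 'd \<Rightarrow> real\<close> that ignores the coordinates outside \<open>I\<close>.
\<close>

section \<open>Multivariate distribution functions and copulas\<close>

definition box_volume :: "'d::finite set \<Rightarrow> (('d \<Rightarrow> real) \<Rightarrow> real) \<Rightarrow> ('d \<Rightarrow> real) \<Rightarrow> ('d \<Rightarrow> real) \<Rightarrow> real" where
  "box_volume I F a b = (\<Sum>S\<in>Pow I. (- 1) ^ card S * F (\<lambda>i. if i \<in> S then a i else b i))"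

definition distribution_function :: "'d::finite set \<Rightarrow> (('d \<Rightarrow> real) \<Rightarrow> real) \<Rightarrow> bool" where
  "distribution_function I F \<longleftrightarrow>
     (\<forall>x y. (\<forall>i\<in>I. x i = y i) \<longrightarrow> F x = F y) \<and>
     (\<forall>a b. (\<forall>i\<in>I. a i \<le> b i) \<longrightarrow> 0 \<le> box_volume I F a b) \<and>
     (\<forall>x. ((\<lambda>t. F (\<lambda>i. x i + t)) \<longlongrightarrow> F x) (at_right 0)) \<and>
     (\<forall>x. \<forall>i\<in>I. ((\<lambda>t. F (x(i := t))) \<longlongrightarrow> 0) at_bot) \<and>
     ((\<lambda>t. F (\<lambda>_. t)) \<longlongrightarrow> 1) at_top"

text \<open>
  The marginal \<open>F\<^sub>A\<close>. As distribution functions are monotone, the coordinates outside \<open>A\<close> may be sent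
  to infinity along the diagonal. For \<open>A = {}\<close> this is the constant 1.
\<close>

definition marginal :: "'d::finite set \<Rightarrow> (('d \<Rightarrow> real) \<Rightarrow> real) \<Rightarrow> ('d \<Rightarrow> real) \<Rightarrow> real" where
  "marginal A F x = Lim at_top (\<lambda>t::real. F (\<lambda>i. if i \<in> A then x i else t))"

definition is_copula :: "'d::finite set \<Rightarrow> (('d \<Rightarrow> real) \<Rightarrow> real) \<Rightarrow> bool" where
  "is_copula I C \<longleftrightarrow>
     (\<forall>u v. (\<forall>i\<in>I. u i = v i) \<longrightarrow> C u = C v) \<and>
     (\<forall>u. (\<forall>i\<in>I. u i \<in> {0..1}) \<and> (\<exists>i\<in>I. u i = 0) \<longrightarrow> C u = 0) \<and>
     (\<forall>i\<in>I. \<forall>t\<in>{0..1}. C ((\<lambda>_. 1)(i := t)) = t) \<and>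
     (\<forall>a b. (\<forall>i\<in>I. 0 \<le> a i \<and> a i \<le> b i \<and> b i \<le> 1) \<longrightarrow> 0 \<le> box_volume I C a b)"

definition is_copula_of :: "'d::finite set \<Rightarrow> (('d \<Rightarrow> real) \<Rightarrow> real) \<Rightarrow> (('d \<Rightarrow> real) \<Rightarrow> real) \<Rightarrow> bool" where
  "is_copula_of I F C \<longleftrightarrow> is_copula I C \<and> (\<forall>x. F x = C (\<lambda>i. marginal {i} F x))"

text \<open>
  By Sklar's theorem a copula of \<open>F\<close> exists and, when \<open>F\<close> has continuous marginals, it is unique on
  the unit cube. Its values outside the cube are irrelevant, hence \<open>SOME\<close> and not \<open>THE\<close>.
\<close>

definition copula_of :: "'d::finite set \<Rightarrow> (('d \<Rightarrow> real) \<Rightarrow> real) \<Rightarrow> ('d \<Rightarrow> real) \<Rightarrow> real" where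
  "copula_of I F = (SOME C. is_copula_of I F C)"

definition unit_frechet :: "real \<Rightarrow> real" where
  "unit_frechet x = (if 0 < x then exp (- 1 / x) else 0)"

definition unit_frechet_marginals :: "(('d::finite \<Rightarrow> real) \<Rightarrow> real) \<Rightarrow> bool" where
  "unit_frechet_marginals F \<longleftrightarrow> (\<forall>j x. marginal {j} F x = unit_frechet (x j))"

section \<open>Multivariate extreme value distributions\<close>

text \<open>MEV distributions are the max-stable distributions with nondegenerate marginals.\<close>

definition mev :: "'d::finite set \<Rightarrow> (('d \<Rightarrow> real) \<Rightarrow> real) \<Rightarrow> bool" where
  "mev I F \<longleftrightarrow>
     distribution_function I F \<and>
     (\<forall>i\<in>I. \<exists>x. marginal {i} F x \<notin> {0, 1}) \<and>
     (\<forall>n\<ge>1. \<exists>a b. (\<forall>i\<in>I. 0 < a i) \<and> (\<forall>x. F (\<lambda>i. a i * x i + b i) ^ n = F x))"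

definition in_domain_of_attraction ::
  "(('d::finite \<Rightarrow> real) \<Rightarrow> real) \<Rightarrow> (('d \<Rightarrow> real) \<Rightarrow> real) \<Rightarrow> bool" where
  "in_domain_of_attraction F G \<longleftrightarrow>
     (\<forall>u. (\<forall>j. u j \<in> {0..1}) \<longrightarrow>
       (\<lambda>n. copula_of UNIV F (\<lambda>j. u j powr (1 / real n)) ^ n) \<longlonglongrightarrow> copula_of UNIV G u)"

text \<open>The coefficient of an empty sub-distribution is 0 by convention.\<close>

definition extremal_coefficient :: "'d::finite set \<Rightarrow> (('d \<Rightarrow> real) \<Rightarrow> real) \<Rightarrow> real" where
  "extremal_coefficient I F =
     (if I = {} then 0 else (THE e. \<forall>u\<in>{0..1}. copula_of I F (\<lambda>_. u) = u powr e))"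

section \<open>Sequences of random vectors\<close>

text \<open>Sequences are indexed from 0, so the first \<open>n\<close> terms are those with index below \<open>n\<close>.\<close>

abbreviation vec_borel :: "('d::finite \<Rightarrow> real) measure" where
  "vec_borel \<equiv> PiM UNIV (\<lambda>_. borel)"

abbreviation seq_borel :: "(nat \<Rightarrow> 'd::finite \<Rightarrow> real) measure" where
  "seq_borel \<equiv> PiM UNIV (\<lambda>_. vec_borel)"

definition joint_cdf :: "'a measure \<Rightarrow> ('a \<Rightarrow> 'd::finite \<Rightarrow> real) \<Rightarrow> ('d \<Rightarrow> real) \<Rightarrow> real" where
  "joint_cdf M W x = measure M {\<omega> \<in> space M. \<forall>j. W \<omega> j \<le> x j}"

definition stationary :: "'a measure \<Rightarrow> (nat \<Rightarrow> 'a \<Rightarrow> 'd::finite \<Rightarrow> real) \<Rightarrow> bool" where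
  "stationary M W \<longleftrightarrow> (\<forall>n. W n \<in> measurable M vec_borel) \<and>
     (\<forall>k. distr M seq_borel (\<lambda>\<omega> n. W (n + k) \<omega>) = distr M seq_borel (\<lambda>\<omega> n. W n \<omega>))"

definition iid :: "'a measure \<Rightarrow> (nat \<Rightarrow> 'a \<Rightarrow> 'd::finite \<Rightarrow> real) \<Rightarrow> bool" where
  "iid M W \<longleftrightarrow> prob_space.indep_vars M (\<lambda>_. vec_borel) W UNIV \<and>
     (\<forall>n. distr M vec_borel (W n) = distr M vec_borel (W 0))"

definition comp_max :: "nat \<Rightarrow> (nat \<Rightarrow> 'd \<Rightarrow> real) \<Rightarrow> 'd \<Rightarrow> real" where
  "comp_max n w j = (MAX i\<in>{..<n}. w i j)"

text \<open>
  The probability space \<open>N n\<close> carries \<open>n\<close> independent vectors with the common distribution of the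
  sequence \<open>W\<close>. Only \<open>\<tau>\<close> with positive components matter.
\<close>

definition has_extremal_index ::
  "'a measure \<Rightarrow> (nat \<Rightarrow> 'a \<Rightarrow> 'd::finite \<Rightarrow> real) \<Rightarrow> (('d \<Rightarrow> real) \<Rightarrow> real) \<Rightarrow> bool" where
  "has_extremal_index M W \<theta> \<longleftrightarrow>
     (let N = (\<lambda>n. PiM {..<n} (\<lambda>_. distr M vec_borel (W 0))) in
      \<forall>\<tau>. (\<forall>j. 0 < \<tau> j) \<longrightarrow> \<theta> \<tau> \<in> {0..1} \<and>
        (\<exists>u \<gamma>.
          (\<forall>j. (\<lambda>n. real n * (1 - measure M {\<omega> \<in> space M. W 0 \<omega> j \<le> u n j})) \<longlonglongrightarrow> \<tau> j) \<and>
          (\<lambda>n. measure (N n) {w \<in> space (N n). \<forall>j. comp_max n w j \<le> u n j}) \<longlonglongrightarrow> \<gamma> \<and>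
          (\<lambda>n. measure M {\<omega> \<in> space M. \<forall>j. comp_max n (\<lambda>i. W i \<omega>) j \<le> u n j}) \<longlonglongrightarrow> \<gamma> powr \<theta> \<tau>))"

definition sub_index :: "(('d::finite \<Rightarrow> real) \<Rightarrow> real) \<Rightarrow> 'd set \<Rightarrow> ('d \<Rightarrow> real) \<Rightarrow> real" where
  "sub_index \<theta> A \<tau> =
     Lim (at (\<lambda>_. 0) within {s. \<forall>j. 0 < s j}) (\<lambda>s. \<theta> (\<lambda>j. if j \<in> A then \<tau> j else s j))"

text \<open>By homogeneity of \<open>\<theta>\<close> the value given to \<open>\<tau> j\<close> is irrelevant; it is taken to be 1.\<close>

definition marginal_index :: "(('d::finite \<Rightarrow> real) \<Rightarrow> real) \<Rightarrow> 'd \<Rightarrow> real" where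
  "marginal_index \<theta> j = sub_index \<theta> {j} (\<lambda>_. 1)"

section \<open>The pMAX process\<close>

definition pmax_process :: "('d \<Rightarrow> real) \<Rightarrow> (nat \<Rightarrow> 'a \<Rightarrow> 'd \<Rightarrow> real) \<Rightarrow> (nat \<Rightarrow> 'a \<Rightarrow> 'd \<Rightarrow> real)
    \<Rightarrow> nat \<Rightarrow> 'a \<Rightarrow> 'd \<Rightarrow> real" where
  "pmax_process \<alpha> X Z n \<omega> j = max (X n \<omega> j) (Z n \<omega> j powr (1 / \<alpha> j))"

definition pmax_U :: "('d \<Rightarrow> real) \<Rightarrow> 'd set" where
  "pmax_U \<alpha> = {j. 1 \<le> \<alpha> j}"

text \<open>
  As distribution functions on the whole space, \<open>V\<close> and its analogue without the extremal index
  vanish outside the open positive orthant. An empty marginal contributes the factor 1.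
\<close>

definition pmax_V :: "('d::finite \<Rightarrow> real) \<Rightarrow> (('d \<Rightarrow> real) \<Rightarrow> real) \<Rightarrow> (('d \<Rightarrow> real) \<Rightarrow> real)
    \<Rightarrow> (('d \<Rightarrow> real) \<Rightarrow> real) \<Rightarrow> ('d \<Rightarrow> real) \<Rightarrow> real" where
  "pmax_V \<alpha> \<theta> G H x =
     (if \<forall>j. 0 < x j
      then marginal (pmax_U \<alpha>) G x powr sub_index \<theta> (pmax_U \<alpha>) (\<lambda>j. 1 / x j)
             * marginal (- pmax_U \<alpha>) H (\<lambda>j. x j powr \<alpha> j)
      else 0)"

definition pmax_Vhat :: "('d::finite \<Rightarrow> real) \<Rightarrow> (('d \<Rightarrow> real) \<Rightarrow> real) \<Rightarrow> (('d \<Rightarrow> real) \<Rightarrow> real)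
    \<Rightarrow> ('d \<Rightarrow> real) \<Rightarrow> real" where
  "pmax_Vhat \<alpha> G H x =
     (if \<forall>j. 0 < x j
      then marginal (pmax_U \<alpha>) G x * marginal (- pmax_U \<alpha>) H (\<lambda>j. x j powr \<alpha> j)
      else 0)"

end

theory Submission
  imports Defs "HOL-Real_Asymp.Real_Asymp"
begin

text \<open>
  Both distributions are products of a factor in the coordinates of \<open>U\<close> and a factor in the
  others, and the logarithm of a product is a sum. What has to be shown is that the factors are
  MEV distributions, and how an extremal coefficient is read off.

  For a max-stable \<open>F\<close> with marginals \<open>exp (- c / x powr a)\<close> (the predicate \<open>frechet_mev\<close>),
  max-stability extends to real powers, and following the diagonal of the copula gives
  \<open>- ln (F (c powr (1 / a)))\<close> for the extremal coefficient
  (\<open>extremal_coefficient_frechet_mev\<close>). The class is closed under marginals, under powers of the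
  coordinates and under products over disjoint blocks. It contains \<open>G\<close> and \<open>H\<close>, so \<open>Vhat\<close> belongs
  to it, with all scales \<open>c\<close> equal to 1. If \<open>V\<close> belongs to it too, with scales \<open>\<theta>m\<close> on \<open>U\<close>, its
  coefficient is \<open>- ln\<close> of its value at \<open>\<theta>m\<close> (and 1 outside \<open>U\<close>), which is the claimed formula.

  The hard point is that \<open>G\<^sub>U powr \<theta>\<^sub>U\<close> is a distribution function. It cannot be checked on a
  formula, as the index is an unspecified function. It holds because the function \<open>L\<close> that sends
  \<open>x\<close> to \<open>G x powr \<theta> (1 / x)\<close> is the pointwise limit of the distribution functions of
  \<open>M\<^sub>n / n\<close>, where \<open>M\<^sub>n\<close> is the maximum of the first \<open>n\<close> terms of the stationary sequence
  (\<open>comp_max_limit\<close>). Nonnegative box volumes pass to the limit and to its \<open>U\<close>-marginal. Moreover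
  \<open>\<theta>\<close> is the quotient of \<open>ln L\<close> and \<open>ln G\<close> at \<open>1 / \<tau>\<close>, so its limit \<open>\<theta>\<^sub>U\<close> exists for nonempty
  \<open>U\<close>, and \<open>G\<^sub>U powr \<theta>\<^sub>U\<close> is the \<open>U\<close>-marginal of \<open>L\<close> (\<open>marginal_powr_sub_index\<close>). For a single
  coordinate, homogeneity of \<open>\<theta>\<close> yields the marginals \<open>exp (- \<theta>m j / x)\<close>.

  Limits of distribution functions may lose right-continuity, hence the auxiliary notion
  \<open>weak_df\<close>. It is harmless because such functions are Lipschitz with respect to their marginals
  (\<open>weak_df_lipschitz\<close>): Frechet marginals restore all continuity, and the same bound gives
  Sklar's theorem for continuous marginals.
\<close>

section \<open>Box volumes\<close>

lemma box_volume_empty [simp]: "box_volume {} F a b = F b"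
  by (simp add: box_volume_def)

text \<open>
  Every induction on box volumes peels off one coordinate: the alternating sum is an iterated
  difference.
\<close>

lemma box_volume_insert:
  fixes J :: "'d::finite set"
  assumes "i \<notin> J"
  shows "box_volume (insert i J) F a b = box_volume J F a b - box_volume J F a (b(i := a i))"
proof -
  have inj: "inj_on (insert i) (Pow J)"
    using assms by (auto simp: inj_on_def)
  have disj: "Pow J \<inter> insert i ` Pow J = {}"
    using assms by auto
  let ?f = "\<lambda>S. (- 1) ^ card S * F (\<lambda>k. if k \<in> S then a k else b k)"
  have "box_volume (insert i J) F a b = sum ?f (Pow J) + sum ?f (insert i ` Pow J)"
    unfolding box_volume_def Pow_insert by (rule sum.union_disjoint) (use disj in auto)
  also have "sum ?f (insert i ` Pow J) = (\<Sum>S\<in>Pow J. ?f (insert i S))"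
    using inj by (simp add: sum.reindex)
  also have "\<dots> = (\<Sum>S\<in>Pow J. - ((- 1) ^ card S * F (\<lambda>k. if k \<in> S then a k else (b(i := a i)) k)))"
  proof (rule sum.cong[OF refl])
    fix S assume "S \<in> Pow J"
    with assms have "i \<notin> S" by auto
    moreover have "(\<lambda>k. if k \<in> insert i S then a k else b k)
        = (\<lambda>k. if k \<in> S then a k else (b(i := a i)) k)"
      by auto
    ultimately show "?f (insert i S) = - ((- 1) ^ card S * F (\<lambda>k. if k \<in> S then a k else (b(i := a i)) k))"
      by simp
  qed
  finally show ?thesis
    by (simp add: box_volume_def sum_negf)
qed

lemma box_volume_cong:
  fixes J :: "'d::finite set"
  assumes "\<And>S. S \<subseteq> J \<Longrightarrow>
    F (\<lambda>i. if i \<in> S then a i else b i) = F' (\<lambda>i. if i \<in> S then a' i else b' i)"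
  shows "box_volume J F a b = box_volume J F' a' b'"
  unfolding box_volume_def using assms by (intro sum.cong) auto

lemma tendsto_box_volume:
  fixes J :: "'d::finite set"
  assumes "\<And>S. S \<subseteq> J \<Longrightarrow>
    ((\<lambda>n. F n (\<lambda>i. if i \<in> S then a n i else b n i)) \<longlongrightarrow> F' (\<lambda>i. if i \<in> S then a' i else b' i)) Fl"
  shows "((\<lambda>n. box_volume J (F n) (a n) (b n)) \<longlongrightarrow> box_volume J F' a' b') Fl"
  unfolding box_volume_def by (intro tendsto_intros assms) auto

section \<open>Weak distribution functions\<close>

text \<open>
  Distribution functions without right-continuity and without the limits at minus infinity, but
  with all lower-dimensional box volumes nonnegative. The first two conditions survive pointwise
  limits, which is how the limit law of the maxima will be obtained. Right-continuity and the
  limits at minus infinity only concern the one-dimensional marginals and are recovered from them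
  at the end.
\<close>

definition weak_df :: "'d::finite set \<Rightarrow> (('d \<Rightarrow> real) \<Rightarrow> real) \<Rightarrow> bool" where
  "weak_df I F \<longleftrightarrow>
     (\<forall>x y. (\<forall>i\<in>I. x i = y i) \<longrightarrow> F x = F y) \<and>
     (\<forall>J a b. J \<subseteq> I \<longrightarrow> (\<forall>i\<in>J. a i \<le> b i) \<longrightarrow> 0 \<le> box_volume J F a b) \<and>
     ((\<lambda>t. F (\<lambda>_. t)) \<longlongrightarrow> 1) at_top"

lemma weak_dfI:
  assumes "\<And>x y. (\<And>i. i \<in> I \<Longrightarrow> x i = y i) \<Longrightarrow> F x = F y"
    and "\<And>J a b. J \<subseteq> I \<Longrightarrow> (\<And>i. i \<in> J \<Longrightarrow> a i \<le> b i) \<Longrightarrow> 0 \<le> box_volume J F a b"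
    and "((\<lambda>t. F (\<lambda>_. t)) \<longlongrightarrow> 1) at_top"
  shows "weak_df I F"
  unfolding weak_df_def using assms by blast

lemma weak_df_cong:
  "weak_df I F \<Longrightarrow> (\<And>i. i \<in> I \<Longrightarrow> x i = y i) \<Longrightarrow> F x = F y"
  by (auto simp: weak_df_def)

lemma weak_df_box:
  "weak_df I F \<Longrightarrow> J \<subseteq> I \<Longrightarrow> (\<And>i. i \<in> J \<Longrightarrow> a i \<le> b i) \<Longrightarrow> 0 \<le> box_volume J F a b"
  by (auto simp: weak_df_def)

lemma weak_df_diagonal: "weak_df I F \<Longrightarrow> ((\<lambda>t. F (\<lambda>_. t)) \<longlongrightarrow> 1) at_top"
  by (auto simp: weak_df_def)

text \<open>
  Boxes in fewer coordinates are limits of boxes in \<open>I\<close>: sending a lower corner to minus infinity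
  makes every term of the alternating sum that contains it vanish.
\<close>

lemma distribution_function_imp_weak_df:
  fixes I :: "'d::finite set"
  assumes "distribution_function I F"
  shows "weak_df I F"
proof (rule weak_dfI)
  show dep: "F x = F y" if "\<And>i. i \<in> I \<Longrightarrow> x i = y i" for x y
    using assms that by (auto simp: distribution_function_def)
  show "((\<lambda>t. F (\<lambda>_. t)) \<longlongrightarrow> 1) at_top"
    using assms by (auto simp: distribution_function_def)
  have ground: "((\<lambda>t. F (x(i := t))) \<longlongrightarrow> 0) at_bot" if "i \<in> I" for x i
    using assms that by (auto simp: distribution_function_def)
  have "0 \<le> box_volume (I - K) F a b" if "\<forall>i\<in>I - K. a i \<le> b i" for a b K
    using finite[of K] that
  proof (induction K arbitrary: a b rule: finite_induct)
    case empty
    then show ?case using assms by (auto simp: distribution_function_def)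
  next
    case (insert k K)
    show ?case
    proof (cases "k \<in> I")
      case False
      then have "I - insert k K = I - K" by auto
      with insert show ?thesis by simp
    next
      case True
      let ?J = "I - insert k K"
      have ins: "insert k ?J = I - K" using True insert by auto
      have eq: "box_volume (I - K) F (a(k := t)) b = box_volume ?J F a b - box_volume ?J F a (b(k := t))" for t
      proof -
        have "box_volume ?J F (a(k := t)) b' = box_volume ?J F a b'" for b'
        proof (rule box_volume_cong)
          fix S assume "S \<subseteq> ?J"
          then have "(\<lambda>i. if i \<in> S then (a(k := t)) i else b' i) = (\<lambda>i. if i \<in> S then a i else b' i)"
            by (intro ext) auto
          then show "F (\<lambda>i. if i \<in> S then (a(k := t)) i else b' i) = F (\<lambda>i. if i \<in> S then a i else b' i)"
            by simp
        qed
        then show ?thesis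
          unfolding ins[symmetric] by (subst box_volume_insert) auto
      qed
      have "((\<lambda>t. box_volume ?J F a (b(k := t))) \<longlongrightarrow> box_volume ?J (\<lambda>_. 0) a b) at_bot"
      proof (rule tendsto_box_volume)
        fix S assume "S \<subseteq> ?J"
        then have "k \<notin> S" by auto
        then have "(\<lambda>i. if i \<in> S then a i else (b(k := t)) i) = (\<lambda>i. if i \<in> S then a i else b i)(k := t)" for t
          by auto
        with ground[OF True] show "((\<lambda>t. F (\<lambda>i. if i \<in> S then a i else (b(k := t)) i)) \<longlongrightarrow> 0) at_bot"
          by simp
      qed
      then have "((\<lambda>t. box_volume (I - K) F (a(k := t)) b) \<longlongrightarrow> box_volume ?J F a b - 0) at_bot"
        unfolding eq by (intro tendsto_diff tendsto_const) (simp add: box_volume_def)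
      moreover have "eventually (\<lambda>t. 0 \<le> box_volume (I - K) F (a(k := t)) b) at_bot"
        using eventually_le_at_bot[of "b k"]
      proof eventually_elim
        case (elim t)
        show ?case
          by (rule insert.IH) (use elim insert.prems in auto)
      qed
      ultimately show ?thesis
        using tendsto_lowerbound[of _ _ at_bot] by fastforce
    qed
  qed
  then have "0 \<le> box_volume (I - (I - J)) F a b" if "\<forall>i\<in>I - (I - J). a i \<le> b i" for J a b
    using that by blast
  then show "0 \<le> box_volume J F a b" if "J \<subseteq> I" "\<And>i. i \<in> J \<Longrightarrow> a i \<le> b i" for J a b
    using that by (metis double_diff subset_refl)
qed

lemma weak_df_nonneg: "weak_df I F \<Longrightarrow> 0 \<le> F x"
  using weak_df_box[of I F "{}"] by simp

lemma weak_df_mono: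
  fixes I :: "'d::finite set"
  assumes F: "weak_df I F" and le: "\<And>i. i \<in> I \<Longrightarrow> x i \<le> y i"
  shows "F x \<le> F y"
proof -
  have "F (\<lambda>i. if i \<in> S then x i else y i) \<le> F y" if "S \<subseteq> I" for S
    using finite[of S] that
  proof (induction S rule: finite_induct)
    case empty
    then show ?case by simp
  next
    case (insert k S)
    let ?w = "\<lambda>i. if i \<in> S then x i else y i"
    have "0 \<le> box_volume (insert k {}) F x ?w"
      by (rule weak_df_box[OF F]) (use insert le in auto)
    then have "F (?w(k := x k)) \<le> F ?w"
      by (subst (asm) box_volume_insert) auto
    moreover have "?w(k := x k) = (\<lambda>i. if i \<in> insert k S then x i else y i)"
      by auto
    ultimately show ?case
      using insert by auto
  qed
  from this[of I] show ?thesis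
    using weak_df_cong[OF F, of x "\<lambda>i. if i \<in> I then x i else y i"] by simp
qed

lemma weak_df_le_1:
  fixes I :: "'d::finite set"
  assumes F: "weak_df I F"
  shows "F x \<le> 1"
proof (rule tendsto_lowerbound[OF weak_df_diagonal[OF F]])
  show "\<forall>\<^sub>F t in at_top. F x \<le> F (\<lambda>_. t)"
    using eventually_ge_at_top[of "Max (range x)"]
    by eventually_elim (rule weak_df_mono[OF F], meson Max_ge finite finite_imageI order_trans rangeI)
qed auto

text \<open>
  This is the inclusion-exclusion inequality for two coordinates, iterated: the increment of a
  distribution function in one coordinate grows with all the other coordinates.
\<close>

lemma weak_df_increment_mono:
  fixes I :: "'d::finite set"
  assumes F: "weak_df I F" and "k \<in> I" "s \<le> t" and le: "\<And>i. i \<in> I \<Longrightarrow> w i \<le> z i"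
  shows "F (w(k := t)) - F (w(k := s)) \<le> F (z(k := t)) - F (z(k := s))"
proof -
  define D where "D w = F (w(k := t)) - F (w(k := s))" for w
  have "D w \<le> D (\<lambda>i. if i \<in> S then z i else w i)" if "S \<subseteq> I" for S
    using finite[of S] that
  proof (induction S rule: finite_induct)
    case empty
    then show ?case by simp
  next
    case (insert j S)
    let ?v = "\<lambda>i. if i \<in> S then z i else w i"
    let ?v' = "\<lambda>i. if i \<in> insert j S then z i else w i"
    have v': "?v' = ?v(j := z j)" by auto
    have "D ?v \<le> D ?v'"
    proof (cases "j = k")
      case True
      then show ?thesis unfolding v' D_def by simp
    next
      case False
      have "0 \<le> box_volume {k, j} F (?v(k := s)) (?v(k := t, j := z j))"
        by (rule weak_df_box[OF F]) (use insert assms False in auto)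
      also have "\<dots> = F (?v(k := t, j := z j)) - F (?v(k := t))
          - (F (?v(k := s, j := z j)) - F (?v(k := s)))"
      proof -
        have *: "?v(k := t, j := z j, j := ?v j) = ?v(k := t)"
          "?v(k := t, j := z j, k := s) = ?v(k := s, j := z j)"
          "?v(k := s, j := z j, j := ?v j) = ?v(k := s)"
          using False by (auto simp: fun_upd_twist)
        show ?thesis
          using False * by (simp add: box_volume_insert del: fun_upd_apply) (simp add: fun_upd_twist)
      qed
      finally show ?thesis
        unfolding v' D_def using False by (simp add: fun_upd_twist)
    qed
    with insert show ?case by simp
  qed
  then have "D w \<le> D (\<lambda>i. if i \<in> I then z i else w i)"
    by simp
  also have "\<dots> = D z"
    unfolding D_def by (intro arg_cong2[where f = "(-)"] weak_df_cong[OF F]) auto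
  finally show ?thesis unfolding D_def .
qed

text \<open>
  The marginal is defined along the diagonal, but by monotonicity the coordinates outside \<open>A\<close> may
  go to infinity at any relative speed and along any filter.
\<close>

lemma tendsto_marginal:
  fixes I :: "'d::finite set"
  assumes F: "weak_df I F" and z: "\<And>i. i \<in> I \<Longrightarrow> i \<notin> A \<Longrightarrow> filterlim (\<lambda>s. z s i) at_top Fl"
  shows "((\<lambda>s. F (\<lambda>i. if i \<in> A then x i else z s i)) \<longlongrightarrow> marginal A F x) Fl"
proof -
  let ?f = "\<lambda>t::real. F (\<lambda>i. if i \<in> A then x i else t)"
  let ?L = "Sup (range ?f)"
  have bdd: "bdd_above (range ?f)"
    using weak_df_le_1[OF F] by (intro bdd_aboveI) auto
  have lim: "((\<lambda>s. F (\<lambda>i. if i \<in> A then x i else z s i)) \<longlongrightarrow> ?L) Fl"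
    if z: "\<And>i. i \<in> I \<Longrightarrow> i \<notin> A \<Longrightarrow> filterlim (\<lambda>s. z s i) at_top Fl" for z :: "'b \<Rightarrow> 'd \<Rightarrow> real" and Fl
  proof (rule order_tendstoI)
    fix l assume "l < ?L"
    then obtain t0 where t0: "l < ?f t0"
      using less_cSUP_iff[OF _ bdd] by auto
    have "\<forall>i\<in>I - A. eventually (\<lambda>s. t0 \<le> z s i) Fl"
      using z by (auto simp: filterlim_at_top)
    then have "eventually (\<lambda>s. \<forall>i\<in>I - A. t0 \<le> z s i) Fl"
      by (intro eventually_ball_finite) auto
    then show "eventually (\<lambda>s. l < F (\<lambda>i. if i \<in> A then x i else z s i)) Fl"
    proof eventually_elim
      case (elim s)
      have "?f t0 \<le> F (\<lambda>i. if i \<in> A then x i else z s i)"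
        by (rule weak_df_mono[OF F]) (use elim in auto)
      with t0 show ?case by simp
    qed
  next
    fix u assume u: "?L < u"
    show "eventually (\<lambda>s. F (\<lambda>i. if i \<in> A then x i else z s i) < u) Fl"
    proof (rule always_eventually, rule allI)
      fix s
      have "F (\<lambda>i. if i \<in> A then x i else z s i) \<le> ?f (Max (range (z s)))"
        by (rule weak_df_mono[OF F]) auto
      also have "\<dots> \<le> ?L"
        using bdd by (intro cSUP_upper) auto
      finally show "F (\<lambda>i. if i \<in> A then x i else z s i) < u"
        using u by simp
    qed
  qed
  have "(?f \<longlongrightarrow> ?L) at_top"
  proof (rule order_tendstoI)
    fix l assume "l < ?L"
    then obtain t0 where t0: "l < ?f t0"
      using less_cSUP_iff[OF _ bdd] by auto
    show "eventually (\<lambda>t. l < ?f t) at_top"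
      using eventually_ge_at_top[of t0]
    proof eventually_elim
      case (elim t)
      have "?f t0 \<le> ?f t"
        by (rule weak_df_mono[OF F]) (use elim in auto)
      with t0 show ?case by simp
    qed
  next
    fix u assume "?L < u"
    then show "eventually (\<lambda>t. ?f t < u) at_top"
      using cSUP_upper[OF _ bdd] by (intro always_eventually) (meson UNIV_I le_less_trans)
  qed
  then have "marginal A F x = ?L"
    unfolding marginal_def by (intro tendsto_Lim) auto
  with lim[OF z] show ?thesis by simp
qed

lemma tendsto_marginal_diagonal:
  "weak_df I F \<Longrightarrow> ((\<lambda>t. F (\<lambda>i. if i \<in> A then x i else t)) \<longlongrightarrow> marginal A F x) at_top"
  by (rule tendsto_marginal) (auto simp: filterlim_ident)

lemma marginal_eq_limit:
  assumes "((\<lambda>t. F (\<lambda>i. if i \<in> A then x i else t)) \<longlongrightarrow> l) at_top"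
  shows "marginal A F x = l"
  unfolding marginal_def by (rule tendsto_Lim) (use assms in auto)

lemma marginal_cong:
  assumes "\<And>i. i \<in> A \<Longrightarrow> x i = y i"
  shows "marginal A F x = marginal A F y"
proof -
  have "(\<lambda>i. if i \<in> A then x i else t) = (\<lambda>i. if i \<in> A then y i else t)" for t
    using assms by auto
  then show ?thesis by (simp add: marginal_def)
qed

lemma marginal_self:
  assumes "weak_df I F" shows "marginal I F = F"
proof
  fix x
  have "F (\<lambda>i. if i \<in> I then x i else t) = F x" for t
    by (rule weak_df_cong[OF assms]) auto
  then show "marginal I F x = F x"
    by (intro marginal_eq_limit) simp
qed

lemma marginal_empty:
  assumes "weak_df I F" shows "marginal {} F x = 1"
  using weak_df_diagonal[OF assms] by (intro marginal_eq_limit) simp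

lemma weak_df_le_marginal:
  assumes F: "weak_df I F" shows "F x \<le> marginal A F x"
proof (rule tendsto_lowerbound[OF tendsto_marginal_diagonal[OF F]])
  show "\<forall>\<^sub>F t in at_top. F x \<le> F (\<lambda>i. if i \<in> A then x i else t)"
    using eventually_ge_at_top[of "Max (range x)"]
  proof eventually_elim
    case (elim t)
    have "x i \<le> t" for i
      using elim by (meson Max_ge finite finite_imageI order_trans rangeI)
    then show ?case by (intro weak_df_mono[OF F]) auto
  qed
qed auto

lemma weak_df_marginal:
  assumes F: "weak_df I F"
  shows "weak_df A (marginal A F)"
proof (rule weak_dfI)
  show "marginal A F x = marginal A F y" if "\<And>i. i \<in> A \<Longrightarrow> x i = y i" for x y
    using that by (rule marginal_cong)
  fix J a b assume J: "J \<subseteq> A" and ab: "\<And>i. i \<in> J \<Longrightarrow> a i \<le> (b i :: real)"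
  let ?b = "\<lambda>t i. if i \<in> A then b i else t"
  have "((\<lambda>t. box_volume J F a (?b t)) \<longlongrightarrow> box_volume J (marginal A F) a b) at_top"
  proof (rule tendsto_box_volume)
    fix S assume "S \<subseteq> J"
    then have *: "(\<lambda>i. if i \<in> S then a i else ?b t i)
        = (\<lambda>i. if i \<in> A then (if i \<in> S then a i else b i) else t)" for t
      using J by (intro ext) auto
    show "((\<lambda>t. F (\<lambda>i. if i \<in> S then a i else ?b t i)) \<longlongrightarrow> marginal A F (\<lambda>i. if i \<in> S then a i else b i)) at_top"
      unfolding * by (rule tendsto_marginal_diagonal[OF F])
  qed
  moreover have "0 \<le> box_volume J F a (?b t)" for t
  proof -
    have "box_volume J F a (?b t) = box_volume (J \<inter> I) F a (?b t)
        \<or> box_volume J F a (?b t) = 0"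
    proof (cases "J \<subseteq> I")
      case False
      then obtain k where k: "k \<in> J" "k \<notin> I" by auto
      have "box_volume (J - {k}) F a ((?b t)(k := a k)) = box_volume (J - {k}) F a (?b t)"
        by (rule box_volume_cong, rule weak_df_cong[OF F]) (use k in auto)
      then have "box_volume (insert k (J - {k})) F a (?b t) = 0"
        by (subst box_volume_insert) auto
      with k show ?thesis by (simp add: insert_absorb)
    qed (simp add: Int_absorb2)
    then show ?thesis
      using weak_df_box[OF F, of "J \<inter> I" a "?b t"] ab J by fastforce
  qed
  ultimately show "0 \<le> box_volume J (marginal A F) a b"
    by (intro tendsto_lowerbound[of _ _ at_top]) auto
next
  show "((\<lambda>t. marginal A F (\<lambda>_. t)) \<longlongrightarrow> 1) at_top"
  proof (rule tendsto_sandwich[OF _ _ weak_df_diagonal[OF F] tendsto_const])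
    have "marginal A F x \<le> 1" for x
      by (rule tendsto_upperbound[OF tendsto_marginal_diagonal[OF F]])
        (use weak_df_le_1[OF F] in auto)
    then show "\<forall>\<^sub>F t in at_top. marginal A F (\<lambda>_. t) \<le> 1"
      by simp
  qed (simp add: weak_df_le_marginal[OF F])
qed

text \<open>
  Along the diagonal of the outer limit, \<open>marginal A F\<close> is squeezed between \<open>F\<close> and its limit
  \<open>marginal B F\<close>.
\<close>

lemma marginal_marginal:
  assumes F: "weak_df I F" and "B \<subseteq> A"
  shows "marginal B (marginal A F) x = marginal B F x"
proof (rule marginal_eq_limit)
  show "((\<lambda>t. marginal A F (\<lambda>i. if i \<in> B then x i else t)) \<longlongrightarrow> marginal B F x) at_top"
  proof (rule tendsto_sandwich[OF _ _ tendsto_marginal_diagonal[OF F] tendsto_const])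
    have "marginal A F (\<lambda>i. if i \<in> B then x i else t) \<le> marginal B F x" for t
    proof (rule tendsto_upperbound[OF tendsto_marginal_diagonal[OF F]])
      have "F (\<lambda>i. if i \<in> A then if i \<in> B then x i else t else s) \<le> marginal B F x" for s
      proof -
        have "F (\<lambda>i. if i \<in> A then if i \<in> B then x i else t else s)
            \<le> marginal B F (\<lambda>i. if i \<in> A then if i \<in> B then x i else t else s)"
          by (rule weak_df_le_marginal[OF F])
        also have "\<dots> = marginal B F x"
          by (rule marginal_cong) (use assms in auto)
        finally show ?thesis .
      qed
      then show "\<forall>\<^sub>F s in at_top. F (\<lambda>i. if i \<in> A then if i \<in> B then x i else t else s) \<le> marginal B F x"
        by simp
    qed auto
    then show "\<forall>\<^sub>F t in at_top. marginal A F (\<lambda>i. if i \<in> B then x i else t) \<le> marginal B F x"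
      by simp
  qed (simp add: weak_df_le_marginal[OF F])
qed

lemma marginal_singleton_mono:
  assumes F: "weak_df I F" and "s i \<le> t i"
  shows "marginal {i} F s \<le> marginal {i} F t"
  by (rule weak_df_mono[OF weak_df_marginal[OF F]]) (use assms in auto)

text \<open>
  Lower the coordinates one at a time. Each step is an increment in a single coordinate, which
  only grows when the other coordinates are sent to infinity.
\<close>

lemma weak_df_diff_le:
  fixes I :: "'d::finite set"
  assumes F: "weak_df I F" and xy: "\<And>i. i \<in> I \<Longrightarrow> x i \<le> y i"
  shows "F y - F x \<le> (\<Sum>i\<in>I. marginal {i} F y - marginal {i} F x)"
proof -
  have step: "F w - F (w(k := x k)) \<le> marginal {k} F y - marginal {k} F x" if "k \<in> I" "w k = y k" for w k
  proof (rule tendsto_lowerbound)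
    show "((\<lambda>t. F (\<lambda>i. if i \<in> {k} then y i else t) - F (\<lambda>i. if i \<in> {k} then x i else t))
        \<longlongrightarrow> marginal {k} F y - marginal {k} F x) at_top"
      by (intro tendsto_intros tendsto_marginal_diagonal[OF F])
    show "\<forall>\<^sub>F t in at_top. F w - F (w(k := x k))
        \<le> F (\<lambda>i. if i \<in> {k} then y i else t) - F (\<lambda>i. if i \<in> {k} then x i else t)"
      using eventually_ge_at_top[of "Max (range w)"]
    proof eventually_elim
      case (elim t)
      have le: "w i \<le> t" for i
        using elim by (meson Max_ge finite finite_imageI order_trans rangeI)
      have "F (w(k := y k)) - F (w(k := x k)) \<le> F ((\<lambda>_. t)(k := y k)) - F ((\<lambda>_. t)(k := x k))"
        by (rule weak_df_increment_mono[OF F]) (use that xy le in auto)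
      moreover have "w(k := y k) = w" using that by auto
      moreover have "(\<lambda>i. if i \<in> {k} then v i else t) = (\<lambda>_. t)(k := v k)" for v
        by auto
      ultimately show ?case by simp
    qed
  qed auto
  have "F y - F (\<lambda>i. if i \<in> S then x i else y i) \<le> (\<Sum>i\<in>S. marginal {i} F y - marginal {i} F x)"
    if "S \<subseteq> I" for S
    using finite[of S] that
  proof (induction S rule: finite_induct)
    case empty
    then show ?case by simp
  next
    case (insert k S)
    let ?w = "\<lambda>i. if i \<in> S then x i else y i"
    have "?w(k := x k) = (\<lambda>i. if i \<in> insert k S then x i else y i)"
      by auto
    with step[of k ?w] insert show ?case by (auto simp: sum.insert)
  qed
  from this[of I] show ?thesis
    using weak_df_cong[OF F, of x "\<lambda>i. if i \<in> I then x i else y i"] by simp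
qed

text \<open>
  Distribution functions are Lipschitz with respect to their marginals. All joint continuity used
  below comes from this bound.
\<close>

lemma weak_df_lipschitz:
  fixes I :: "'d::finite set"
  assumes F: "weak_df I F"
  shows "\<bar>F x - F y\<bar> \<le> (\<Sum>i\<in>I. \<bar>marginal {i} F x - marginal {i} F y\<bar>)"
proof -
  have *: "F x - F y \<le> (\<Sum>i\<in>I. \<bar>marginal {i} F x - marginal {i} F y\<bar>)" for x y
  proof -
    let ?m = "\<lambda>i. min (x i) (y i)"
    have "F x - F y \<le> F x - F ?m"
      using weak_df_mono[OF F, of ?m y] by simp
    also have "\<dots> \<le> (\<Sum>i\<in>I. marginal {i} F x - marginal {i} F ?m)"
      by (rule weak_df_diff_le[OF F]) auto
    also have "\<dots> \<le> (\<Sum>i\<in>I. \<bar>marginal {i} F x - marginal {i} F y\<bar>)"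
    proof (rule sum_mono)
      fix i
      show "marginal {i} F x - marginal {i} F ?m \<le> \<bar>marginal {i} F x - marginal {i} F y\<bar>"
        using marginal_cong[of "{i}" ?m x F] marginal_cong[of "{i}" ?m y F]
        by (cases "x i \<le> y i") auto
    qed
    finally show ?thesis .
  qed
  from *[of x y] *[of y x] show ?thesis
    by (auto simp: abs_minus_commute abs_le_iff)
qed

lemma tendsto_if_marginals_tendsto:
  fixes I :: "'d::finite set"
  assumes F: "weak_df I F"
    and "\<And>i. i \<in> I \<Longrightarrow> ((\<lambda>n. marginal {i} F (x n)) \<longlongrightarrow> marginal {i} F y) Fl"
  shows "((\<lambda>n. F (x n)) \<longlongrightarrow> F y) Fl"
proof -
  have "((\<lambda>n. \<Sum>i\<in>I. \<bar>marginal {i} F (x n) - marginal {i} F y\<bar>) \<longlongrightarrow> 0) Fl"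
    by (rule tendsto_null_sum) (use assms(2) in \<open>auto intro!: tendsto_rabs_zero simp: LIM_zero\<close>)
  then have "((\<lambda>n. F (x n) - F y) \<longlongrightarrow> 0) Fl"
    by (rule Lim_null_comparison[rotated]) (use weak_df_lipschitz[OF F] in auto)
  then show ?thesis by (rule LIM_zero_cancel)
qed

text \<open>
  The Lipschitz bound lifts regularity from the one-dimensional marginals to the whole function.
\<close>

lemma weak_df_imp_distribution_function:
  fixes I :: "'d::finite set"
  assumes F: "weak_df I F"
    and right: "\<And>i s. i \<in> I \<Longrightarrow> ((\<lambda>t. marginal {i} F (\<lambda>_. s + t)) \<longlongrightarrow> marginal {i} F (\<lambda>_. s)) (at_right 0)"
    and bot: "\<And>i. i \<in> I \<Longrightarrow> ((\<lambda>t. marginal {i} F (\<lambda>_. t)) \<longlongrightarrow> 0) at_bot"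
  shows "distribution_function I F"
  unfolding distribution_function_def
proof (intro conjI allI impI ballI)
  show "F x = F y" if "\<forall>i\<in>I. x i = y i" for x y
    using weak_df_cong[OF F] that by blast
  show "0 \<le> box_volume I F a b" if "\<forall>i\<in>I. a i \<le> b i" for a b
    using weak_df_box[OF F] that by blast
  show "((\<lambda>t. F (\<lambda>_. t)) \<longlongrightarrow> 1) at_top"
    by (rule weak_df_diagonal[OF F])
  show "((\<lambda>t. F (\<lambda>i. x i + t)) \<longlongrightarrow> F x) (at_right 0)" for x
  proof (rule tendsto_if_marginals_tendsto[OF F])
    fix i assume i: "i \<in> I"
    have "marginal {i} F (\<lambda>k. x k + t) = marginal {i} F (\<lambda>_. x i + t)"
      "marginal {i} F x = marginal {i} F (\<lambda>_. x i)" for t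
      by (auto intro: marginal_cong)
    with right[OF i, of "x i"]
    show "((\<lambda>t. marginal {i} F (\<lambda>i. x i + t)) \<longlongrightarrow> marginal {i} F x) (at_right 0)"
      by simp
  qed
  show "((\<lambda>t. F (x(i := t))) \<longlongrightarrow> 0) at_bot" if "i \<in> I" for x i
  proof (rule tendsto_sandwich[OF _ _ tendsto_const bot[OF that]])
    have "F (x(i := t)) \<le> marginal {i} F (\<lambda>_. t)" for t
      using weak_df_le_marginal[OF F, of "x(i := t)" "{i}"]
        marginal_cong[of "{i}" "x(i := t)" "\<lambda>_. t" F] by simp
    then show "\<forall>\<^sub>F t in at_bot. F (x(i := t)) \<le> marginal {i} F (\<lambda>_. t)"
      by simp
  qed (simp add: weak_df_nonneg[OF F])
qed

section \<open>Sklar's theorem for continuous marginals\<close>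

lemma marginal_tendsto_1:
  fixes I :: "'d::finite set"
  assumes F: "weak_df I F"
  shows "((\<lambda>t. marginal {i} F (\<lambda>_. t)) \<longlongrightarrow> 1) at_top"
  by (rule weak_df_diagonal[OF weak_df_marginal[OF F]])

text \<open>
  The loss from passing to finite values outside \<open>A\<close> is at most the total mass that the
  one-dimensional marginals put above these values.
\<close>

lemma marginal_diff_le:
  fixes I :: "'d::finite set"
  assumes F: "weak_df I F"
  shows "marginal A F x - F x \<le> (\<Sum>j\<in>I - A. 1 - marginal {j} F x)"
proof (rule tendsto_upperbound)
  show "((\<lambda>t. F (\<lambda>i. if i \<in> A then x i else t) - F x) \<longlongrightarrow> marginal A F x - F x) at_top"
    by (intro tendsto_intros tendsto_marginal_diagonal[OF F])
  show "\<forall>\<^sub>F t in at_top. F (\<lambda>i. if i \<in> A then x i else t) - F x \<le> (\<Sum>j\<in>I - A. 1 - marginal {j} F x)"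
    using eventually_ge_at_top[of "Max (range x)"]
  proof eventually_elim
    case (elim t)
    let ?y = "\<lambda>i. if i \<in> A then x i else t"
    have "x i \<le> t" for i
      using elim by (meson Max_ge finite finite_imageI order_trans rangeI)
    then have "F ?y - F x \<le> (\<Sum>j\<in>I. marginal {j} F ?y - marginal {j} F x)"
      by (intro weak_df_diff_le[OF F]) auto
    also have "\<dots> = (\<Sum>j\<in>I - A. marginal {j} F ?y - marginal {j} F x)"
    proof (rule sum.mono_neutral_right)
      show "\<forall>j\<in>I - (I - A). marginal {j} F ?y - marginal {j} F x = 0"
        using marginal_cong[of "{j}" ?y x F for j] by auto
    qed auto
    also have "\<dots> \<le> (\<Sum>j\<in>I - A. 1 - marginal {j} F x)"
      by (intro sum_mono diff_right_mono weak_df_le_1[OF weak_df_marginal[OF F]])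
    finally show ?case .
  qed
qed auto

text \<open>
  The copula is \<open>F\<close> composed with quantiles. A quantile of a continuous marginal exists at every
  level in \<open>(0, 1)\<close>; the levels 0 and 1 are reached by pushing \<open>u\<close> into the open cube and passing
  to the limit, which exists by the Lipschitz bound.
\<close>

lemma sklar_continuous:
  fixes I :: "'d::finite set"
  assumes F: "weak_df I F"
    and cont: "\<And>i. i \<in> I \<Longrightarrow> continuous_on UNIV (\<lambda>t. marginal {i} F (\<lambda>_. t))"
    and bot: "\<And>i. i \<in> I \<Longrightarrow> ((\<lambda>t. marginal {i} F (\<lambda>_. t)) \<longlongrightarrow> 0) at_bot"
  shows "is_copula_of I F (copula_of I F)"
proof -
  define m where "m i t = marginal {i} F (\<lambda>_. t)" for i t
  have m_eq: "marginal {i} F x = m i (x i)" for i x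
    unfolding m_def by (rule marginal_cong) auto
  have m_mono: "m i s \<le> m i t" if "s \<le> t" for i s t
    unfolding m_def by (rule marginal_singleton_mono[OF F that])
  have m_bounds: "0 \<le> m i t" "m i t \<le> 1" for i t
    unfolding m_def using weak_df_nonneg[OF weak_df_marginal[OF F]] weak_df_le_1[OF weak_df_marginal[OF F]]
    by auto
  \<comment> \<open>a quantile function; any choice is monotone because it is a right inverse of a monotone function\<close>
  define q where "q i v = (SOME t. m i t = v)" for i v
  have m_q: "m i (q i v) = v" if "i \<in> I" "0 < v" "v < 1" for i v
  proof -
    have "eventually (\<lambda>t. m i t < v) at_bot"
      using order_tendstoD(2)[OF bot[OF \<open>i \<in> I\<close>] \<open>0 < v\<close>] by (simp add: m_def)
    then obtain s where s: "m i s < v"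
      by (auto simp: eventually_at_bot_linorder)
    have "eventually (\<lambda>t. v < m i t) at_top"
      using order_tendstoD(1)[OF marginal_tendsto_1[OF F] \<open>v < 1\<close>] by (simp add: m_def)
    then obtain t where t: "v < m i t"
      by (auto simp: eventually_at_top_linorder)
    have "s \<le> t"
      using m_mono[of t s i] s t by linarith
    moreover have "continuous_on {s..t} (m i)"
      using continuous_on_subset[OF cont[OF \<open>i \<in> I\<close>]] by (simp add: m_def[abs_def])
    ultimately have "\<exists>x. m i x = v"
      using IVT'[of "m i" s v t] s t by auto
    then show ?thesis
      unfolding q_def by (rule someI_ex)
  qed
  have q_mono: "q i v \<le> q i v'" if "i \<in> I" "0 < v" "v \<le> v'" "v' < 1" for i v v'
  proof (cases "v = v'")
    case False
    then have "m i (q i v) < m i (q i v')"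
      using that m_q[of i v] m_q[of i v'] by simp
    then show ?thesis
      using m_mono[of "q i v'" "q i v" i] by linarith
  qed simp
  \<comment> \<open>moves the closed unit interval into the open one, monotonically and with error at most \<open>1 / (n + 2)\<close>\<close>
  define c where "c n u = max (1 / (real n + 2)) (min u (1 - 1 / (real n + 2)))" for n u
  have c_bounds: "0 < c n u" "c n u < 1" for n u
    unfolding c_def by (simp_all add: less_max_iff_disj min_less_iff_disj)
  have c_mono: "c n u \<le> c n v" if "u \<le> v" for n u v
    unfolding c_def using that by auto
  have c_close: "\<bar>c n u - u\<bar> \<le> 1 / (real n + 2)" if "u \<in> {0..1}" for n u
  proof -
    have "1 / (real n + 2) \<le> 1 - 1 / (real n + 2)"
      by (simp add: field_simps)
    moreover have "0 < 1 / (real n + 2)" by simp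
    ultimately show ?thesis
      unfolding c_def using that by (auto simp: max_def min_def)
  qed
  have small: "(\<lambda>n. K * (1 / (real n + 2))) \<longlonglongrightarrow> 0" for K
    by real_asymp
  have c_lim: "(\<lambda>n. c n u) \<longlonglongrightarrow> u" if "u \<in> {0..1}" for u
  proof (rule LIM_zero_cancel, rule Lim_null_comparison)
    show "\<forall>\<^sub>F n in sequentially. norm (c n u - u) \<le> 1 * (1 / (real n + 2))"
      using c_close[OF that] by simp
  qed (rule small)
  define Q where "Q n u = (\<lambda>i. q i (c n (u i)))" for n u
  have m_Q: "m i (Q n u i) = c n (u i)" if "i \<in> I" for i n u
    unfolding Q_def using m_q[OF that c_bounds] .
  define C where "C u = lim (\<lambda>n. F (Q n u))" for u
  have C_lim: "(\<lambda>n. F (Q n u)) \<longlonglongrightarrow> C u" if u: "\<And>i. i \<in> I \<Longrightarrow> u i \<in> {0..1}" for u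
  proof -
    have bound: "\<bar>F (Q n u) - F (Q k u)\<bar>
        \<le> real (card I) * (1 / (real n + 2)) + real (card I) * (1 / (real k + 2))" for n k
    proof -
      have "\<bar>F (Q n u) - F (Q k u)\<bar> \<le> (\<Sum>i\<in>I. \<bar>c n (u i) - c k (u i)\<bar>)"
        using weak_df_lipschitz[OF F, of "Q n u" "Q k u"] by (simp add: m_eq m_Q)
      also have "\<dots> \<le> (\<Sum>i\<in>I. 1 / (real n + 2) + 1 / (real k + 2))"
      proof (rule sum_mono)
        fix i assume "i \<in> I"
        then show "\<bar>c n (u i) - c k (u i)\<bar> \<le> 1 / (real n + 2) + 1 / (real k + 2)"
          using c_close[OF u, of i n] c_close[OF u, of i k] by linarith
      qed
      finally show ?thesis by (simp add: distrib_left)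
    qed
    have "Cauchy (\<lambda>n. F (Q n u))"
    proof (rule metric_CauchyI)
      fix e :: real assume "0 < e"
      then have "eventually (\<lambda>n. real (card I) * (1 / (real n + 2)) < e / 2) sequentially"
        by (intro order_tendstoD(2)[OF small]) auto
      then obtain N where N: "\<And>n. n \<ge> N \<Longrightarrow> real (card I) * (1 / (real n + 2)) < e / 2"
        by (auto simp: eventually_sequentially)
      show "\<exists>N. \<forall>n\<ge>N. \<forall>k\<ge>N. dist (F (Q n u)) (F (Q k u)) < e"
      proof (intro exI allI impI)
        fix n k assume "N \<le> n" "N \<le> k"
        then show "dist (F (Q n u)) (F (Q k u)) < e"
          using N[of n] N[of k] bound[of n k] unfolding dist_real_def by linarith
      qed
    qed
    then have "convergent (\<lambda>n. F (Q n u))"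
      by (rule Cauchy_convergent)
    then show ?thesis
      unfolding C_def by (simp add: convergent_LIMSEQ_iff)
  qed
  have "is_copula I C"
    unfolding is_copula_def
  proof (intro conjI allI impI ballI)
    fix u v :: "'d \<Rightarrow> real" assume "\<forall>i\<in>I. u i = v i"
    then have "F (Q n u) = F (Q n v)" for n
      by (intro weak_df_cong[OF F]) (simp add: Q_def)
    then show "C u = C v" by (simp add: C_def)
  next
    fix u :: "'d \<Rightarrow> real" assume "(\<forall>i\<in>I. u i \<in> {0..1}) \<and> (\<exists>i\<in>I. u i = 0)"
    then obtain i where u: "\<And>i. i \<in> I \<Longrightarrow> u i \<in> {0..1}" and i: "i \<in> I" "u i = 0" by blast
    have "(\<lambda>n. F (Q n u)) \<longlonglongrightarrow> 0"
    proof (rule tendsto_sandwich[OF _ _ tendsto_const])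
      show "(\<lambda>n. c n 0) \<longlonglongrightarrow> 0" by (rule c_lim) simp
      show "\<forall>\<^sub>F n in sequentially. F (Q n u) \<le> c n 0"
        using weak_df_le_marginal[OF F, of "Q n u" "{i}" for n] i by (simp add: m_eq m_Q)
    qed (simp add: weak_df_nonneg[OF F])
    then show "C u = 0"
      using LIMSEQ_unique[OF C_lim[of u, OF u]] by blast
  next
    fix i and t :: real assume i: "i \<in> I" and t: "t \<in> {0..1}"
    define u where "u = (\<lambda>_. 1)(i := t)"
    have u: "u j \<in> {0..1}" for j
      using t by (auto simp: u_def)
    have "(\<lambda>n. F (Q n u)) \<longlonglongrightarrow> t"
    proof (rule tendsto_sandwich)
      show "\<forall>\<^sub>F n in sequentially. c n t - (\<Sum>j\<in>I - {i}. 1 - c n (u j)) \<le> F (Q n u)"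
      proof (rule always_eventually, rule allI)
        fix n
        have "(\<Sum>j\<in>I - {i}. 1 - m j (Q n u j)) = (\<Sum>j\<in>I - {i}. 1 - c n (u j))"
          by (rule sum.cong) (auto simp: m_Q)
        then show "c n t - (\<Sum>j\<in>I - {i}. 1 - c n (u j)) \<le> F (Q n u)"
          using marginal_diff_le[OF F, of "{i}" "Q n u"] i by (simp add: m_eq m_Q u_def)
      qed
      show "\<forall>\<^sub>F n in sequentially. F (Q n u) \<le> c n t"
        using weak_df_le_marginal[OF F, of "Q n u" "{i}" for n] i by (simp add: m_eq m_Q u_def)
      have "(\<lambda>n. c n t - (\<Sum>j\<in>I - {i}. 1 - c n (u j))) \<longlonglongrightarrow> t - (\<Sum>j\<in>I - {i}. 1 - u j)"
        by (intro tendsto_intros c_lim t u)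
      also have "(\<Sum>j\<in>I - {i}. 1 - u j) = 0"
        by (intro sum.neutral) (auto simp: u_def)
      finally show "(\<lambda>n. c n t - (\<Sum>j\<in>I - {i}. 1 - c n (u j))) \<longlonglongrightarrow> t" by simp
      show "(\<lambda>n. c n t) \<longlonglongrightarrow> t" by (rule c_lim[OF t])
    qed
    then show "C ((\<lambda>_. 1)(i := t)) = t"
      using LIMSEQ_unique[OF C_lim[of u, OF u]] unfolding u_def by blast
  next
    fix a b :: "'d \<Rightarrow> real" assume ab: "\<forall>i\<in>I. 0 \<le> a i \<and> a i \<le> b i \<and> b i \<le> 1"
    have "(\<lambda>n. box_volume I F (Q n a) (Q n b)) \<longlonglongrightarrow> box_volume I C a b"
    proof (rule tendsto_box_volume)
      fix S
      have "(\<lambda>i. if i \<in> S then Q n a i else Q n b i) = Q n (\<lambda>i. if i \<in> S then a i else b i)" for n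
        by (auto simp: Q_def)
      moreover have "(if i \<in> S then a i else b i) \<in> {0..1}" if "i \<in> I" for i
        using bspec[OF ab that] by auto
      ultimately show "(\<lambda>n. F (\<lambda>i. if i \<in> S then Q n a i else Q n b i)) \<longlonglongrightarrow> C (\<lambda>i. if i \<in> S then a i else b i)"
        using C_lim[of "\<lambda>i. if i \<in> S then a i else b i"] by simp
    qed
    moreover have "0 \<le> box_volume I F (Q n a) (Q n b)" for n
      by (rule weak_df_box[OF F]) (use ab in \<open>auto simp: Q_def intro!: q_mono c_bounds c_mono\<close>)
    ultimately show "0 \<le> box_volume I C a b"
      by (intro LIMSEQ_le_const) auto
  qed
  moreover have "F x = C (\<lambda>i. marginal {i} F x)" for x
  proof -
    have "(\<lambda>n. F (Q n (\<lambda>i. m i (x i)))) \<longlonglongrightarrow> F x"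
    proof (rule tendsto_if_marginals_tendsto[OF F])
      fix i assume "i \<in> I"
      then show "(\<lambda>n. marginal {i} F (Q n (\<lambda>i. m i (x i)))) \<longlonglongrightarrow> marginal {i} F x"
        using c_lim[of "m i (x i)"] m_bounds by (simp add: m_eq m_Q)
    qed
    moreover have "(\<lambda>n. F (Q n (\<lambda>i. m i (x i)))) \<longlonglongrightarrow> C (\<lambda>i. m i (x i))"
      by (rule C_lim) (use m_bounds in auto)
    ultimately have "F x = C (\<lambda>i. m i (x i))"
      by (rule LIMSEQ_unique)
    then show ?thesis by (simp add: m_eq)
  qed
  ultimately have "is_copula_of I F C"
    by (auto simp: is_copula_of_def)
  then show ?thesis
    unfolding copula_of_def by (rule someI[of "is_copula_of I F"])
qed

section \<open>Max-stable distributions with Frechet marginals\<close>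

definition frechet :: "real \<Rightarrow> real \<Rightarrow> real \<Rightarrow> real" where
  "frechet c a t = (if 0 < t then exp (- c * t powr (- a)) else 0)"

lemma frechet_unit: "frechet 1 1 t = unit_frechet t"
  by (simp add: frechet_def unit_frechet_def powr_minus_divide)

lemma frechet_nonpos [simp]: "t \<le> 0 \<Longrightarrow> frechet c a t = 0"
  by (simp add: frechet_def)

lemma continuous_on_frechet:
  assumes "0 < c" "0 < a"
  shows "continuous_on UNIV (frechet c a)"
proof (rule continuous_at_imp_continuous_on, rule ballI)
  fix t :: real
  let ?g = "\<lambda>t. exp (- c * t powr (- a))"
  consider "t < 0" | "t = 0" | "0 < t" by linarith
  then show "isCont (frechet c a) t"
  proof cases
    case 1
    have "\<forall>\<^sub>F s in nhds t. frechet c a s = 0"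
      using eventually_nhds_in_open[of "{..<0}" t] 1 by (auto elim: eventually_mono)
    then have "isCont (frechet c a) t = isCont (\<lambda>_. 0 :: real) t"
      by (rule isCont_cong)
    then show ?thesis by simp
  next
    case 2
    have "((\<lambda>t. exp (- c * t powr (- a))) \<longlongrightarrow> 0) (at_right 0)"
      using assms by real_asymp
    moreover have "\<forall>\<^sub>F s in at_right 0. ?g s = frechet c a s"
      using eventually_at_right_less[of 0] by eventually_elim (simp add: frechet_def)
    ultimately have right: "(frechet c a \<longlongrightarrow> 0) (at_right 0)"
      using Lim_transform_eventually by fast
    have "\<forall>\<^sub>F s in at_left 0. 0 = frechet c a s"
      by (auto simp: eventually_at_left_field intro: exI[of _ "-1"])
    then have "(frechet c a \<longlongrightarrow> 0) (at_left 0)"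
      using Lim_transform_eventually[OF tendsto_const] by fast
    with right show ?thesis
      by (simp add: 2 isCont_def filterlim_split_at)
  next
    case 3
    have "\<forall>\<^sub>F s in nhds t. frechet c a s = ?g s"
      using eventually_nhds_in_open[of "{0<..}" t] 3
      by (auto elim: eventually_mono simp: frechet_def)
    then have "isCont (frechet c a) t = isCont ?g t"
      by (rule isCont_cong)
    moreover have "isCont ?g t"
      using 3 by (intro continuous_intros) auto
    ultimately show ?thesis by simp
  qed
qed

lemma frechet_at_bot: "(frechet c a \<longlongrightarrow> 0) at_bot"
  by (rule tendsto_eventually, use eventually_le_at_bot[of 0] in eventually_elim) simp

text \<open>
  A normal form of the MEV distributions that occur here: the marginals are the Frechet laws
  \<open>exp (- c / x powr a)\<close>, so the norming constants for max-stability are powers of \<open>n\<close>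
  without translation. The scales \<open>c\<close> will carry the marginal extremal indices and the shapes \<open>a\<close>
  the exponents of the pMAX process.
\<close>

definition frechet_mev ::
  "'d::finite set \<Rightarrow> ('d \<Rightarrow> real) \<Rightarrow> ('d \<Rightarrow> real) \<Rightarrow> (('d \<Rightarrow> real) \<Rightarrow> real) \<Rightarrow> bool" where
  "frechet_mev I c a F \<longleftrightarrow> weak_df I F \<and>
     (\<forall>i\<in>I. 0 < c i \<and> 0 < a i \<and> (\<forall>x. marginal {i} F x = frechet (c i) (a i) (x i))) \<and>
     (\<forall>n\<ge>1. \<forall>x. F (\<lambda>i. real n powr (1 / a i) * x i) ^ n = F x)"

lemma frechet_mevI:
  assumes "weak_df I F"
    and "\<And>i. i \<in> I \<Longrightarrow> 0 < c i" "\<And>i. i \<in> I \<Longrightarrow> 0 < a i"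
    and "\<And>i x. i \<in> I \<Longrightarrow> marginal {i} F x = frechet (c i) (a i) (x i)"
    and "\<And>n x. n \<ge> 1 \<Longrightarrow> F (\<lambda>i. real n powr (1 / a i) * x i) ^ n = F x"
  shows "frechet_mev I c a F"
  using assms by (auto simp: frechet_mev_def)

lemma frechet_mevD:
  assumes "frechet_mev I c a F"
  shows "weak_df I F"
    and "i \<in> I \<Longrightarrow> 0 < c i" "i \<in> I \<Longrightarrow> 0 < a i"
    and "i \<in> I \<Longrightarrow> marginal {i} F x = frechet (c i) (a i) (x i)"
    and "n \<ge> 1 \<Longrightarrow> F (\<lambda>i. real n powr (1 / a i) * x i) ^ n = F x"
  using assms by (auto simp: frechet_mev_def)

lemma frechet_mev_marginal_continuous:
  assumes "frechet_mev I c a F" "i \<in> I"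
  shows "continuous_on UNIV (\<lambda>t. marginal {i} F (\<lambda>_. t))"
  using continuous_on_frechet frechet_mevD(2-4)[OF assms] by (simp add: eta_contract_eq)

lemma frechet_mev_imp_mev:
  assumes F: "frechet_mev I c a F"
  shows "mev I F"
  unfolding mev_def
proof (intro conjI ballI allI impI)
  note FD = frechet_mevD[OF F]
  show "distribution_function I F"
  proof (rule weak_df_imp_distribution_function[OF FD(1)])
    fix i s assume i: "i \<in> I"
    have "isCont (frechet (c i) (a i)) s"
      using continuous_on_frechet[OF FD(2)[OF i] FD(3)[OF i]] by (simp add: continuous_on_eq_continuous_at)
    then have "((\<lambda>t. frechet (c i) (a i) (s + t)) \<longlongrightarrow> frechet (c i) (a i) s) (at 0)"
      by (simp add: isCont_iff)
    then show "((\<lambda>t. marginal {i} F (\<lambda>_. s + t)) \<longlongrightarrow> marginal {i} F (\<lambda>_. s)) (at_right 0)"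
      using i FD(4) by (simp add: filterlim_at_split)
  next
    fix i assume "i \<in> I"
    then show "((\<lambda>t. marginal {i} F (\<lambda>_. t)) \<longlongrightarrow> 0) at_bot"
      using FD(4) frechet_at_bot by (simp add: eta_contract_eq)
  qed
  \<comment> \<open>the value of the marginal at 1 is \<open>exp (- c i)\<close>\<close>
  show "\<exists>x. marginal {i} F x \<notin> {0, 1}" if "i \<in> I" for i
    using FD(2,4)[OF that] by (intro exI[of _ "\<lambda>_. 1"]) (simp add: frechet_def)
  fix n :: nat assume "1 \<le> n"
  then show "\<exists>a b. (\<forall>i\<in>I. 0 < a i) \<and> (\<forall>x. F (\<lambda>i. a i * x i + b i) ^ n = F x)"
    using FD(5) by (intro exI[of _ "\<lambda>i. real n powr (1 / a i)"] exI[of _ "\<lambda>_. 0"]) auto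
qed

lemma frechet_mev_copula:
  assumes F: "frechet_mev I c a F"
  shows "is_copula_of I F (copula_of I F)"
proof (rule sklar_continuous[OF frechet_mevD(1)[OF F]])
  fix i assume i: "i \<in> I"
  show "continuous_on UNIV (\<lambda>t. marginal {i} F (\<lambda>_. t))"
    by (rule frechet_mev_marginal_continuous[OF F i])
  show "((\<lambda>t. marginal {i} F (\<lambda>_. t)) \<longlongrightarrow> 0) at_bot"
    using frechet_mevD(4)[OF F i] frechet_at_bot by (simp add: eta_contract_eq)
qed

text \<open>
  Max-stability writes \<open>F x\<close> as a power of a value of \<open>F\<close> arbitrarily far out, where \<open>F\<close> is close
  to 1.
\<close>

lemma frechet_mev_pos:
  assumes F: "frechet_mev I c a F" and x: "\<And>i. i \<in> I \<Longrightarrow> 0 < x i"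
  shows "0 < F x"
proof -
  note FD = frechet_mevD[OF F]
  have "((\<lambda>n. F (\<lambda>i. if i \<in> {} then x i else real n powr (1 / a i) * x i)) \<longlongrightarrow> marginal {} F x) sequentially"
  proof (rule tendsto_marginal[OF FD(1)])
    fix i assume "i \<in> I"
    then have "0 < a i" "0 < x i" using FD(3) x by auto
    then show "filterlim (\<lambda>n. real n powr (1 / a i) * x i) at_top sequentially"
      by real_asymp
  qed
  then have "(\<lambda>n. F (\<lambda>i. real n powr (1 / a i) * x i)) \<longlonglongrightarrow> 1"
    by (simp add: marginal_empty[OF FD(1)])
  then have "eventually (\<lambda>n. 0 < F (\<lambda>i. real n powr (1 / a i) * x i)) sequentially"
    by (rule order_tendstoD) simp
  then have "eventually (\<lambda>n. 0 < F (\<lambda>i. real n powr (1 / a i) * x i) \<and> 1 \<le> n) sequentially"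
    using eventually_ge_at_top[of 1] by (rule eventually_conj)
  then obtain n where "0 < F (\<lambda>i. real n powr (1 / a i) * x i)" "1 \<le> n"
    by (auto simp: eventually_sequentially)
  then have "0 < F (\<lambda>i. real n powr (1 / a i) * x i) ^ n"
    by simp
  then show ?thesis
    using FD(5)[OF \<open>1 \<le> n\<close>, of x] by simp
qed

text \<open>
  Stability under integer powers extends to real powers by monotonicity alone: \<open>k\<close> is squeezed
  between the rationals with denominator \<open>N\<close>.
\<close>

lemma frechet_mev_scale:
  assumes F: "frechet_mev I c a F" and x: "\<And>i. i \<in> I \<Longrightarrow> 0 < x i" and k: "0 < k"
  shows "F (\<lambda>i. k powr (1 / a i) * x i) = F x powr (1 / k)"
proof -
  note FD = frechet_mevD[OF F]
  define P where "P t = F (\<lambda>i. t powr (1 / a i) * x i)" for t :: real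
  have P_pos: "0 < P t" if "0 < t" for t
    unfolding P_def by (rule frechet_mev_pos[OF F]) (use x that in auto)
  have P_le1: "P t \<le> 1" for t
    unfolding P_def by (rule weak_df_le_1[OF FD(1)])
  have P_mono: "P s \<le> P t" if "0 < s" "s \<le> t" for s t
    unfolding P_def
  proof (rule weak_df_mono[OF FD(1)])
    fix i assume "i \<in> I"
    then show "s powr (1 / a i) * x i \<le> t powr (1 / a i) * x i"
      using that x FD(3) by (intro mult_right_mono powr_mono2) (auto simp: less_imp_le)
  qed
  have P_ln: "ln (P (real n * t)) = ln (P t) / real n" if "0 < t" "1 \<le> n" for n t
  proof -
    have "P (real n * t) ^ n = P t"
      using FD(5)[OF that(2), of "\<lambda>i. t powr (1 / a i) * x i"] that
      by (simp add: P_def powr_mult mult.assoc)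
    moreover have "ln (P (real n * t) ^ n) = real n * ln (P (real n * t))"
      using P_pos[of "real n * t"] that by (simp add: ln_realpow)
    ultimately have "real n * ln (P (real n * t)) = ln (P t)"
      by simp
    then show ?thesis using that by (simp add: field_simps)
  qed
  have P1: "ln (P 1) \<le> 0"
    using P_pos[of 1] P_le1[of 1] by simp
  have bounds: "\<forall>\<^sub>F N in sequentially. real N / (real N * k - 1) * ln (P 1) \<le> ln (P k)
      \<and> ln (P k) \<le> real N / (real N * k + 1) * ln (P 1)"
  proof -
    have "filterlim (\<lambda>N. real N * k) at_top sequentially"
      using k by real_asymp
    then have "\<forall>\<^sub>F N in sequentially. 2 \<le> real N * k"
      by (simp add: filterlim_at_top)
    then show ?thesis
      using eventually_ge_at_top[of 1]
    proof eventually_elim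
      case (elim N)
      \<comment> \<open>the two values of \<open>P\<close> at integers around \<open>N * k\<close> are known powers of \<open>P 1\<close>\<close>
      define m where "m = nat \<lfloor>real N * k\<rfloor>"
      have m: "real m \<le> real N * k" "real N * k < real m + 1" "1 \<le> m"
        using elim by (auto simp: m_def le_nat_iff le_floor_iff)
      have "ln (P 1) / real m \<le> ln (P k) / real N"
        using P_ln[of 1 m] P_ln[of k N] P_pos[of "real m"] m k elim
          ln_mono[OF P_mono[of "real m" "real N * k"] P_pos[of "real m"]]
        by simp
      then have 1: "real N / real m * ln (P 1) \<le> ln (P k)"
        using m elim by (simp add: field_simps)
      have "ln (P k) / real N \<le> ln (P 1) / real (m + 1)"
        using P_ln[of 1 "m + 1"] P_ln[of k N] m k elim
          ln_mono[OF P_mono[of "real N * k" "real (m + 1)"] P_pos[of "real N * k"]]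
        by simp
      then have 2: "ln (P k) \<le> real N / (real m + 1) * ln (P 1)"
        using m elim by (simp add: field_simps)
      have "real N / real m \<le> real N / (real N * k - 1)"
        using m elim by (intro divide_left_mono) auto
      then have "real N / (real N * k - 1) * ln (P 1) \<le> real N / real m * ln (P 1)"
        using P1 by (rule mult_right_mono_neg)
      moreover have "real N / (real N * k + 1) \<le> real N / (real m + 1)"
        using m elim k by (intro divide_left_mono) auto
      then have "real N / (real m + 1) * ln (P 1) \<le> real N / (real N * k + 1) * ln (P 1)"
        using P1 by (rule mult_right_mono_neg)
      ultimately show ?case using 1 2 by linarith
    qed
  qed
  have l1: "(\<lambda>N. real N / (real N * k - 1)) \<longlonglongrightarrow> 1 / k"
    unfolding inverse_eq_divide[symmetric] using k by real_asymp
  have l2: "(\<lambda>N. real N / (real N * k + 1)) \<longlonglongrightarrow> 1 / k"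
    unfolding inverse_eq_divide[symmetric] using k by real_asymp
  have "1 / k * ln (P 1) \<le> ln (P k)"
    by (rule tendsto_upperbound[OF tendsto_mult[OF l1 tendsto_const]])
      (use bounds in \<open>auto elim: eventually_mono\<close>)
  moreover have "ln (P k) \<le> 1 / k * ln (P 1)"
    by (rule tendsto_lowerbound[OF tendsto_mult[OF l2 tendsto_const]])
      (use bounds in \<open>auto elim: eventually_mono\<close>)
  ultimately have "ln (P k) = 1 / k * ln (P 1)" by linarith
  moreover have "P k = exp (ln (P k))"
    using P_pos[of k] k by simp
  moreover have "exp (1 / k * ln (P 1)) = P 1 powr (1 / k)"
    using P_pos[of 1] by (simp add: powr_def)
  ultimately have "P k = P 1 powr (1 / k)" by metis
  then show ?thesis by (simp add: P_def)
qed

text \<open>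
  All marginals take the common value \<open>u\<close> at the point \<open>(c i / s) powr (1 / a i)\<close> with
  \<open>s = - ln u\<close>, so the diagonal of the copula at \<open>u\<close> is the value of \<open>F\<close> there; real scaling
  turns it into the power \<open>s\<close> of the value at \<open>s = 1\<close>.
\<close>

lemma extremal_coefficient_frechet_mev:
  assumes F: "frechet_mev I c a F"
  shows "extremal_coefficient I F = - ln (F (\<lambda>i. c i powr (1 / a i)))"
proof (cases "I = {}")
  case True
  have "F x = 1" for x
    using marginal_self[OF frechet_mevD(1)[OF F]] marginal_empty[OF frechet_mevD(1)[OF F]]
    by (simp add: True)
  then show ?thesis by (simp add: extremal_coefficient_def True)
next
  case False
  note FD = frechet_mevD[OF F]
  define e where "e = - ln (F (\<lambda>i. c i powr (1 / a i)))"
  have C: "is_copula I (copula_of I F)" and sklar: "F x = copula_of I F (\<lambda>i. marginal {i} F x)" for x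
    using frechet_mev_copula[OF F] by (auto simp: is_copula_of_def)
  have C_cong: "copula_of I F u = copula_of I F v" if "\<forall>i\<in>I. u i = v i" for u v
    using C that unfolding is_copula_def by blast
  have C_margin: "copula_of I F ((\<lambda>_. 1)(i := t)) = t" if "i \<in> I" "t \<in> {0..1}" for i t
    using C that unfolding is_copula_def by blast
  have C_ground: "copula_of I F u = 0" if "\<forall>i\<in>I. u i \<in> {0..1}" "\<exists>i\<in>I. u i = 0" for u
    using C that unfolding is_copula_def by blast
  have diag: "copula_of I F (\<lambda>_. u) = u powr e" if "u \<in> {0..1}" for u
  proof -
    consider "u = 0" | "u = 1" | "0 < u" "u < 1" using \<open>u \<in> {0..1}\<close> by fastforce
    then show ?thesis
    proof cases
      case 1
      with C_ground[of "\<lambda>_. 0"] False show ?thesis by auto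
    next
      case 2
      obtain i where "i \<in> I" using False by auto
      then have "copula_of I F ((\<lambda>_. 1)(i := 1)) = 1"
        by (rule C_margin) simp
      moreover have "(\<lambda>_. 1)(i := 1) = (\<lambda>_. 1 :: real)" by auto
      ultimately show ?thesis using 2 by simp
    next
      case 3
      define s where "s = - ln u"
      have s: "0 < s" "exp (- s) = u" using 3 by (auto simp: s_def)
      let ?e = "\<lambda>i. c i powr (1 / a i)"
      let ?x = "\<lambda>i. (1 / s) powr (1 / a i) * ?e i"
      have e_pos: "0 < ?e i" if "i \<in> I" for i
        using FD(2)[OF that] by simp
      have "marginal {i} F ?x = u" if "i \<in> I" for i
      proof -
        have ca: "0 < c i" "0 < a i" using FD(2,3) that by auto
        have "?x i = (c i / s) powr (1 / a i)"
          using s ca by (simp add: powr_mult[symmetric])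
        then have "(?x i) powr (- a i) = s / c i"
          using s ca by (simp add: powr_powr powr_minus_divide)
        moreover have "0 < ?x i" using s ca by simp
        ultimately show ?thesis
          using FD(4)[OF that, of ?x] s ca by (simp add: frechet_def)
      qed
      then have "copula_of I F (\<lambda>_. u) = copula_of I F (\<lambda>i. marginal {i} F ?x)"
        by (intro C_cong) auto
      also have "\<dots> = F ?x" by (rule sklar[symmetric])
      also have "\<dots> = F ?e powr (1 / (1 / s))"
        by (rule frechet_mev_scale[OF F, where x = ?e]) (use e_pos s in auto)
      also have "\<dots> = u powr e"
      proof -
        have "0 < F ?e"
          by (rule frechet_mev_pos[OF F e_pos])
        then show ?thesis
          using 3 by (simp add: powr_def e_def s_def)
      qed
      finally show ?thesis .
    qed
  qed
  have "(THE e. \<forall>u\<in>{0..1}. copula_of I F (\<lambda>_. u) = u powr e) = e"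
  proof (rule the_equality)
    show "\<forall>u\<in>{0..1}. copula_of I F (\<lambda>_. u) = u powr e" using diag by auto
    fix e' assume "\<forall>u\<in>{0..1}. copula_of I F (\<lambda>_. u) = u powr e'"
    from this[rule_format, of "1 / 2"] have "(1 / 2) powr e = (1 / 2) powr e'"
      using diag[of "1 / 2"] by simp
    then show "e' = e" by (simp add: powr_inj)
  qed
  then show ?thesis using False by (simp add: extremal_coefficient_def e_def)
qed

lemma filterlim_const_mult_at_top:
  fixes k :: real
  assumes "0 < k"
  shows "filterlim (\<lambda>t. k * t) at_top at_top"
  using assms by (intro filterlim_tendsto_pos_mult_at_top[OF tendsto_const]) (auto simp: filterlim_ident)

text \<open>
  The diagonal that defines the marginal is rescaled with different speeds in different
  coordinates, which does not change the limit.
\<close>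

lemma marginal_max_stable:
  assumes F: "weak_df I F"
    and stable: "\<And>x. F (\<lambda>i. real n powr (1 / a i) * x i) ^ n = F x" and n: "1 \<le> n"
  shows "marginal A F (\<lambda>i. real n powr (1 / a i) * x i) ^ n = marginal A F x"
proof -
  let ?s = "\<lambda>x i. real n powr (1 / a i) * x i"
  have "((\<lambda>t. F (\<lambda>i. if i \<in> A then ?s x i else real n powr (1 / a i) * t) ^ n)
      \<longlongrightarrow> marginal A F (?s x) ^ n) at_top"
    using n by (intro tendsto_power tendsto_marginal[OF F] filterlim_const_mult_at_top) auto
  moreover have "F (\<lambda>i. if i \<in> A then ?s x i else real n powr (1 / a i) * t) ^ n
      = F (\<lambda>i. if i \<in> A then x i else t)" for t
  proof -
    have "(\<lambda>i. if i \<in> A then ?s x i else real n powr (1 / a i) * t) = ?s (\<lambda>i. if i \<in> A then x i else t)"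
      by auto
    then show ?thesis using stable by simp
  qed
  ultimately show ?thesis
    using tendsto_unique[OF _ _ tendsto_marginal_diagonal[OF F]] by simp
qed

lemma frechet_mev_marginal:
  assumes F: "frechet_mev I c a F" and A: "A \<subseteq> I"
  shows "frechet_mev A c a (marginal A F)"
proof (rule frechet_mevI)
  note FD = frechet_mevD[OF F]
  show "weak_df A (marginal A F)"
    by (rule weak_df_marginal[OF FD(1)])
  show "0 < c i" "0 < a i" if "i \<in> A" for i
    using FD(2,3) A that by auto
  show "marginal {i} (marginal A F) x = frechet (c i) (a i) (x i)" if "i \<in> A" for i x
    using that A FD(4) by (subst marginal_marginal[OF FD(1)]) auto
  show "marginal A F (\<lambda>i. real n powr (1 / a i) * x i) ^ n = marginal A F x" if "1 \<le> n" for n x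
    using FD(1) FD(5)[OF that] that by (rule marginal_max_stable)
qed

lemma marginal_coordinate_change:
  fixes I :: "'d::finite set" and \<phi> :: "'d \<Rightarrow> real \<Rightarrow> real"
  assumes F: "weak_df I F" and top: "\<And>i. i \<in> I \<Longrightarrow> filterlim (\<phi> i) at_top at_top"
  shows "marginal A (\<lambda>x. F (\<lambda>i. \<phi> i (x i))) x = marginal A F (\<lambda>i. \<phi> i (x i))"
proof (rule marginal_eq_limit)
  have "((\<lambda>t. F (\<lambda>i. if i \<in> A then \<phi> i (x i) else \<phi> i t)) \<longlongrightarrow> marginal A F (\<lambda>i. \<phi> i (x i))) at_top"
    by (rule tendsto_marginal[OF F]) (use top in auto)
  then show "((\<lambda>t. F (\<lambda>i. \<phi> i (if i \<in> A then x i else t))) \<longlongrightarrow> marginal A F (\<lambda>i. \<phi> i (x i))) at_top"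
    by (simp add: if_distrib)
qed

lemma weak_df_coordinate_change:
  fixes I :: "'d::finite set" and \<phi> :: "'d \<Rightarrow> real \<Rightarrow> real"
  assumes F: "weak_df I F" and top: "\<And>i. i \<in> I \<Longrightarrow> filterlim (\<phi> i) at_top at_top"
    and mono: "\<And>i. i \<in> I \<Longrightarrow> mono (\<phi> i)"
  shows "weak_df I (\<lambda>x. F (\<lambda>i. \<phi> i (x i)))"
proof (rule weak_dfI)
  show "F (\<lambda>i. \<phi> i (x i)) = F (\<lambda>i. \<phi> i (y i))" if "\<And>i. i \<in> I \<Longrightarrow> x i = y i" for x y
    by (rule weak_df_cong[OF F]) (simp add: that)
  fix J and a b :: "'d \<Rightarrow> real" assume J: "J \<subseteq> I" "\<And>i. i \<in> J \<Longrightarrow> a i \<le> b i"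
  have "box_volume J (\<lambda>x. F (\<lambda>i. \<phi> i (x i))) a b = box_volume J F (\<lambda>i. \<phi> i (a i)) (\<lambda>i. \<phi> i (b i))"
    by (rule box_volume_cong) (simp add: if_distrib)
  also have "\<dots> \<ge> 0"
    by (rule weak_df_box[OF F J(1)]) (use J mono in \<open>auto simp: mono_def\<close>)
  finally show "0 \<le> box_volume J (\<lambda>x. F (\<lambda>i. \<phi> i (x i))) a b" .
next
  have "((\<lambda>t. F (\<lambda>i. if i \<in> {} then 0 else \<phi> i t)) \<longlongrightarrow> marginal {} F (\<lambda>_. 0)) at_top"
    by (rule tendsto_marginal[OF F]) (use top in auto)
  then show "((\<lambda>t. F (\<lambda>i. \<phi> i t)) \<longlongrightarrow> 1) at_top"
    by (simp add: marginal_empty[OF F])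
qed

text \<open>
  Truncation at 0 keeps the change of coordinates monotone on the whole line and sends the
  complement of the open orthant to points where the distribution vanishes.
\<close>

lemma frechet_mev_powr:
  assumes F: "frechet_mev I c a F" and \<alpha>: "\<And>i. i \<in> I \<Longrightarrow> 0 < \<alpha> i"
  shows "frechet_mev I c (\<lambda>i. a i * \<alpha> i) (\<lambda>x. F (\<lambda>i. max 0 (x i) powr \<alpha> i))"
proof (rule frechet_mevI)
  note FD = frechet_mevD[OF F]
  let ?\<phi> = "\<lambda>i t. max 0 t powr \<alpha> i"
  have top: "filterlim (?\<phi> i) at_top at_top" if "i \<in> I" for i
  proof -
    have "filterlim (\<lambda>t. t powr \<alpha> i) at_top at_top"
      using \<alpha>[OF that] by real_asymp
    then show ?thesis
      by (rule filterlim_cong[THEN iffD1, rotated -1, OF _ refl refl])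
        (use eventually_ge_at_top[of 0] in \<open>auto elim!: eventually_mono simp: max_def\<close>)
  qed
  have mono: "mono (?\<phi> i)" if "i \<in> I" for i
    using \<alpha>[OF that] by (intro monoI powr_mono2) auto
  show "weak_df I (\<lambda>x. F (\<lambda>i. ?\<phi> i (x i)))"
    by (rule weak_df_coordinate_change[OF FD(1) top mono])
  show "0 < c i" "0 < a i * \<alpha> i" if "i \<in> I" for i
    using FD(2,3)[OF that] \<alpha>[OF that] by auto
  show "marginal {i} (\<lambda>x. F (\<lambda>i. ?\<phi> i (x i))) x = frechet (c i) (a i * \<alpha> i) (x i)" if "i \<in> I" for i x
  proof -
    have "marginal {i} (\<lambda>x. F (\<lambda>i. ?\<phi> i (x i))) x = frechet (c i) (a i) (?\<phi> i (x i))"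
      using marginal_coordinate_change[OF FD(1), of ?\<phi>] top FD(4)[OF that] by simp
    also have "\<dots> = frechet (c i) (a i * \<alpha> i) (x i)"
      using \<alpha>[OF that] by (auto simp: frechet_def powr_powr max_def mult.commute)
    finally show ?thesis .
  qed
  show "F (\<lambda>i. ?\<phi> i (real n powr (1 / (a i * \<alpha> i)) * x i)) ^ n = F (\<lambda>i. ?\<phi> i (x i))"
    if n: "1 \<le> n" for n x
  proof -
    have "F (\<lambda>i. ?\<phi> i (real n powr (1 / (a i * \<alpha> i)) * x i)) = F (\<lambda>i. real n powr (1 / a i) * ?\<phi> i (x i))"
    proof (rule weak_df_cong[OF FD(1)])
      fix i assume i: "i \<in> I"
      have "max 0 (real n powr (1 / (a i * \<alpha> i)) * x i) = real n powr (1 / (a i * \<alpha> i)) * max 0 (x i)"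
        using n by (auto simp: max_def mult_le_0_iff zero_le_mult_iff)
      then show "?\<phi> i (real n powr (1 / (a i * \<alpha> i)) * x i) = real n powr (1 / a i) * ?\<phi> i (x i)"
        using \<alpha>[OF i] by (simp add: powr_mult powr_powr)
    qed
    then show ?thesis using FD(5)[OF n] by simp
  qed
qed

lemma box_volume_mult:
  fixes A J :: "'d::finite set"
  assumes F: "\<And>x y. (\<And>i. i \<in> A \<Longrightarrow> x i = y i) \<Longrightarrow> F x = F y"
    and F': "\<And>x y. (\<And>i. i \<notin> A \<Longrightarrow> x i = y i) \<Longrightarrow> F' x = F' y"
  shows "box_volume J (\<lambda>x. F x * F' x) a b = box_volume (J \<inter> A) F a b * box_volume (J - A) F' a b"
  using finite[of J]
proof (induction J arbitrary: b rule: finite_induct)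
  case empty
  then show ?case by simp
next
  case (insert k J)
  show ?case
  proof (cases "k \<in> A")
    case True
    then have "box_volume (J - A) F' a (b(k := a k)) = box_volume (J - A) F' a b"
      by (intro box_volume_cong F') auto
    with True insert show ?thesis
      by (simp add: box_volume_insert Int_insert_left insert_Diff_if left_diff_distrib del: fun_upd_apply)
  next
    case False
    then have "box_volume (J \<inter> A) F a (b(k := a k)) = box_volume (J \<inter> A) F a b"
      by (intro box_volume_cong F) auto
    with False insert show ?thesis
      by (simp add: box_volume_insert Int_insert_left insert_Diff_if right_diff_distrib del: fun_upd_apply)
  qed
qed

text \<open>
  The law of two independent blocks of coordinates: box volumes factor, so scales and shapes are
  just put together.
\<close>

lemma frechet_mev_mult:
  fixes A :: "'d::finite set"
  assumes F: "frechet_mev A c a F" and F': "frechet_mev (- A) c' a' F'"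
  shows "frechet_mev UNIV (\<lambda>i. if i \<in> A then c i else c' i) (\<lambda>i. if i \<in> A then a i else a' i)
    (\<lambda>x. F x * F' x)"
proof (rule frechet_mevI)
  note FD = frechet_mevD[OF F] and FD' = frechet_mevD[OF F']
  show "weak_df UNIV (\<lambda>x. F x * F' x)"
  proof (rule weak_dfI)
    show "F x * F' x = F y * F' y" if "\<And>i. i \<in> UNIV \<Longrightarrow> x i = y i" for x y
    proof -
      have "x = y" using that by auto
      then show ?thesis by simp
    qed
    have "((\<lambda>t. F (\<lambda>_. t) * F' (\<lambda>_. t)) \<longlongrightarrow> 1 * 1) at_top"
      by (intro tendsto_mult weak_df_diagonal[OF FD(1)] weak_df_diagonal[OF FD'(1)])
    then show "((\<lambda>t. F (\<lambda>_. t) * F' (\<lambda>_. t)) \<longlongrightarrow> 1) at_top"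
      by simp
    fix J and a b :: "'d \<Rightarrow> real" assume J: "\<And>i. i \<in> J \<Longrightarrow> a i \<le> b i"
    have "box_volume J (\<lambda>x. F x * F' x) a b = box_volume (J \<inter> A) F a b * box_volume (J - A) F' a b"
    proof (rule box_volume_mult)
      show "F x = F y" if "\<And>i. i \<in> A \<Longrightarrow> x i = y i" for x y
        using that by (rule weak_df_cong[OF FD(1)])
      show "F' x = F' y" if "\<And>i. i \<notin> A \<Longrightarrow> x i = y i" for x y
        by (rule weak_df_cong[OF FD'(1)]) (simp add: that)
    qed
    also have "\<dots> \<ge> 0"
      by (intro mult_nonneg_nonneg weak_df_box[OF FD(1)] weak_df_box[OF FD'(1)]) (use J in auto)
    finally show "0 \<le> box_volume J (\<lambda>x. F x * F' x) a b" .
  qed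
  show "0 < (if i \<in> A then c i else c' i)" "0 < (if i \<in> A then a i else a' i)" for i
    using FD(2,3) FD'(2,3) by auto
  show "marginal {i} (\<lambda>x. F x * F' x) x = frechet (if i \<in> A then c i else c' i) (if i \<in> A then a i else a' i) (x i)" for i x
  proof -
    have split: "marginal {i} (\<lambda>x. F x * F' x) x = marginal {i} F x * marginal {i} F' x"
      by (intro marginal_eq_limit tendsto_mult tendsto_marginal_diagonal[OF FD(1)] tendsto_marginal_diagonal[OF FD'(1)])
    show ?thesis
    proof (cases "i \<in> A")
      case True
      have "marginal {i} F' x = 1"
      proof (rule marginal_eq_limit)
        have "F' (\<lambda>k. if k \<in> {i} then x k else t) = F' (\<lambda>_. t)" for t
          by (rule weak_df_cong[OF FD'(1)]) (use True in auto)
        then show "((\<lambda>t. F' (\<lambda>k. if k \<in> {i} then x k else t)) \<longlongrightarrow> 1) at_top"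
          using weak_df_diagonal[OF FD'(1)] by simp
      qed
      then show ?thesis using split True FD(4) by simp
    next
      case False
      have "marginal {i} F x = 1"
      proof (rule marginal_eq_limit)
        have "F (\<lambda>k. if k \<in> {i} then x k else t) = F (\<lambda>_. t)" for t
          by (rule weak_df_cong[OF FD(1)]) (use False in auto)
        then show "((\<lambda>t. F (\<lambda>k. if k \<in> {i} then x k else t)) \<longlongrightarrow> 1) at_top"
          using weak_df_diagonal[OF FD(1)] by simp
      qed
      then show ?thesis using split False FD'(4) by simp
    qed
  qed
  show "(F (\<lambda>i. real n powr (1 / (if i \<in> A then a i else a' i)) * x i) *
      F' (\<lambda>i. real n powr (1 / (if i \<in> A then a i else a' i)) * x i)) ^ n = F x * F' x"
    if n: "1 \<le> n" for n x
  proof -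
    have "F (\<lambda>i. real n powr (1 / (if i \<in> A then a i else a' i)) * x i) = F (\<lambda>i. real n powr (1 / a i) * x i)"
      by (rule weak_df_cong[OF FD(1)]) auto
    moreover have "F' (\<lambda>i. real n powr (1 / (if i \<in> A then a i else a' i)) * x i) = F' (\<lambda>i. real n powr (1 / a' i) * x i)"
      by (rule weak_df_cong[OF FD'(1)]) auto
    ultimately show ?thesis
      using FD(5)[OF n] FD'(5)[OF n] by (simp add: power_mult_distrib)
  qed
qed

text \<open>
  The unknown norming constants in the definition of max-stability are forced by the marginals:
  comparing \<open>exp (- n / (a i * s + b i))\<close> with \<open>exp (- 1 / s)\<close> gives
  \<open>a i * s + b i = n * s\<close> for every \<open>s > 0\<close>.
\<close>

lemma mev_imp_frechet_mev:
  fixes G :: "('d::finite \<Rightarrow> real) \<Rightarrow> real"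
  assumes mev: "mev UNIV G" and margins: "unit_frechet_marginals G"
  shows "frechet_mev UNIV (\<lambda>_. 1) (\<lambda>_. 1) G"
proof (rule frechet_mevI)
  show G: "weak_df UNIV G"
    using mev distribution_function_imp_weak_df by (auto simp: mev_def)
  show margin: "marginal {i} G x = frechet 1 1 (x i)" for i x
    using margins by (simp add: unit_frechet_marginals_def frechet_unit)
  show "G (\<lambda>i. real n powr (1 / 1) * x i) ^ n = G x" if n: "1 \<le> n" for n x
  proof (cases "\<forall>i. 0 < x i")
    case False
    then obtain i where "x i \<le> 0" by (auto simp: not_less)
    then have "marginal {i} G x = 0" "marginal {i} G (\<lambda>i. real n * x i) = 0"
      using n by (auto simp: margin mult_le_0_iff)
    then have "G x = 0" "G (\<lambda>i. real n * x i) = 0"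
      using weak_df_le_marginal[OF G] weak_df_nonneg[OF G] by (metis antisym)+
    with n show ?thesis by simp
  next
    case True
    obtain a b where a: "\<And>i. 0 < a i" and stable: "\<And>x. G (\<lambda>i. a i * x i + b i) ^ n = G x"
      using mev n unfolding mev_def by blast
    have "a i * s + b i = real n * s" if s: "0 < s" for i s
    proof -
      let ?x = "\<lambda>_. s"
      have "((\<lambda>t. G (\<lambda>k. if k \<in> {i} then a k * s + b k else a k * t + b k) ^ n)
          \<longlongrightarrow> marginal {i} G (\<lambda>k. a k * s + b k) ^ n) at_top"
      proof (intro tendsto_power tendsto_marginal[OF G])
        fix k
        show "filterlim (\<lambda>t. a k * t + b k) at_top at_top"
          using a[of k] by real_asymp
      qed
      moreover have "G (\<lambda>k. if k \<in> {i} then a k * s + b k else a k * t + b k) ^ n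
          = G (\<lambda>k. if k \<in> {i} then s else t)" for t
        using stable[of "\<lambda>k. if k \<in> {i} then s else t"] by (simp add: if_distrib if_distribR cong: if_cong)
      ultimately have "marginal {i} G (\<lambda>k. a k * s + b k) ^ n = marginal {i} G ?x"
        using tendsto_unique[OF _ _ tendsto_marginal_diagonal[OF G]] by simp
      then have eq: "frechet 1 1 (a i * s + b i) ^ n = exp (- 1 / s)"
        using s by (simp add: margin frechet_unit unit_frechet_def)
      then have pos: "0 < a i * s + b i"
        using n by (cases "a i * s + b i \<le> 0") (auto simp: power_0_left)
      with eq have "exp (real n * (- 1 / (a i * s + b i))) = exp (- 1 / s)"
        by (simp only: frechet_unit unit_frechet_def exp_of_nat_mult if_True)
      then have "real n * (- 1 / (a i * s + b i)) = - 1 / s"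
        by (simp only: exp_inj_iff)
      with pos s show ?thesis by (simp add: field_simps)
    qed
    then have "(\<lambda>i. a i * x i + b i) = (\<lambda>i. real n * x i)"
      using True by auto
    then show ?thesis using stable[of x] by simp
  qed
qed auto

section \<open>Distribution functions of random vectors\<close>

lemma measurable_coordinate:
  fixes W :: "'a \<Rightarrow> 'd::finite \<Rightarrow> real"
  assumes "W \<in> measurable M vec_borel"
  shows "(\<lambda>\<omega>. W \<omega> j) \<in> borel_measurable M"
  by (rule measurable_compose[OF assms measurable_component_singleton]) simp

context prob_space
begin

lemma joint_cdf_event:
  fixes W :: "'a \<Rightarrow> 'd::finite \<Rightarrow> real"
  assumes [measurable]: "W \<in> measurable M vec_borel"
  shows "{\<omega> \<in> space M. (\<forall>j\<in>A. W \<omega> j \<le> b j) \<and> (\<forall>j\<in>J. a j < W \<omega> j)} \<in> sets M"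
proof -
  have [measurable]: "(\<lambda>\<omega>. W \<omega> j) \<in> borel_measurable M" for j
    by (rule measurable_coordinate[OF assms])
  have [simp]: "finite A" "finite J" by auto
  show ?thesis by measurable
qed

lemma box_volume_joint_cdf:
  fixes W :: "'a \<Rightarrow> 'd::finite \<Rightarrow> real"
  assumes W: "W \<in> measurable M vec_borel" and "\<And>i. i \<in> J \<Longrightarrow> a i \<le> b i"
  shows "box_volume J (joint_cdf M W) a b
    = prob {\<omega> \<in> space M. (\<forall>j\<in>UNIV. W \<omega> j \<le> b j) \<and> (\<forall>j\<in>J. a j < W \<omega> j)}"
  using finite[of J] assms(2)
proof (induction J arbitrary: b rule: finite_induct)
  case empty
  then show ?case by (simp add: joint_cdf_def)
next
  case (insert k J)
  let ?E = "\<lambda>b J. {\<omega> \<in> space M. (\<forall>j\<in>UNIV. W \<omega> j \<le> b j) \<and> (\<forall>j\<in>J. a j < W \<omega> j)}"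
  have "box_volume (insert k J) (joint_cdf M W) a b = prob (?E b J) - prob (?E (b(k := a k)) J)"
  proof -
    have "box_volume J (joint_cdf M W) a b = prob (?E b J)"
      by (rule insert.IH) (use insert in auto)
    moreover have "box_volume J (joint_cdf M W) a (b(k := a k)) = prob (?E (b(k := a k)) J)"
      by (rule insert.IH) (use insert in auto)
    ultimately show ?thesis using insert by (simp add: box_volume_insert del: fun_upd_apply)
  qed
  also have "\<dots> = prob (?E b J - ?E (b(k := a k)) J)"
  proof (rule finite_measure_Diff[symmetric])
    show "?E (b(k := a k)) J \<subseteq> ?E b J"
      using insert.prems[of k] by (auto split: if_splits intro: order_trans)
  qed (rule joint_cdf_event[OF W])+
  also have "?E b J - ?E (b(k := a k)) J = ?E b (insert k J)"
    using insert by (auto simp: not_le)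
  finally show ?case .
qed

lemma weak_df_joint_cdf:
  fixes W :: "'a \<Rightarrow> 'd::finite \<Rightarrow> real"
  assumes W: "W \<in> measurable M vec_borel"
  shows "weak_df UNIV (joint_cdf M W)"
proof (rule weak_dfI)
  show "joint_cdf M W x = joint_cdf M W y" if "\<And>i. i \<in> UNIV \<Longrightarrow> x i = y i" for x y
    using that by (simp add: joint_cdf_def)
  show "0 \<le> box_volume J (joint_cdf M W) a b" if "\<And>i. i \<in> J \<Longrightarrow> a i \<le> b i" for J a b
    using box_volume_joint_cdf[OF W that] by simp
  show "((\<lambda>t. joint_cdf M W (\<lambda>_. t)) \<longlongrightarrow> 1) at_top"
  proof (rule tendsto_sandwich[OF _ _ _ tendsto_const])
    have [measurable]: "(\<lambda>\<omega>. W \<omega> j) \<in> borel_measurable M" for j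
      by (rule measurable_coordinate[OF W])
    have cdf: "cdf (distr M borel (\<lambda>\<omega>. W \<omega> j)) = (\<lambda>t. prob {\<omega> \<in> space M. W \<omega> j \<le> t})" for j
      unfolding cdf_def2 by (rule ext, subst measure_distr) (auto intro!: arg_cong[where f = prob])
    have "((\<lambda>t. prob {\<omega> \<in> space M. W \<omega> j \<le> t}) \<longlongrightarrow> 1) at_top" for j
      using real_distribution.cdf_lim_at_top_prob[OF real_distribution_distr, of "\<lambda>\<omega>. W \<omega> j"]
      by (simp add: cdf)
    then have "((\<lambda>t. 1 - (\<Sum>j\<in>UNIV. 1 - prob {\<omega> \<in> space M. W \<omega> j \<le> t}))
        \<longlongrightarrow> 1 - (\<Sum>j\<in>(UNIV::'d set). 1 - 1)) at_top"
      by (intro tendsto_intros)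
    then show "((\<lambda>t. 1 - (\<Sum>j\<in>UNIV. 1 - prob {\<omega> \<in> space M. W \<omega> j \<le> t})) \<longlongrightarrow> 1) at_top"
      by simp
    show "\<forall>\<^sub>F t in at_top. 1 - (\<Sum>j\<in>UNIV. 1 - prob {\<omega> \<in> space M. W \<omega> j \<le> t}) \<le> joint_cdf M W (\<lambda>_. t)"
    proof (rule always_eventually, rule allI)
      fix t
      let ?A = "{\<omega> \<in> space M. \<forall>j. W \<omega> j \<le> t}" and ?B = "\<lambda>j. {\<omega> \<in> space M. W \<omega> j \<le> t}"
      have "1 - prob ?A = prob (space M - ?A)"
        by (rule prob_compl[symmetric]) measurable
      also have "space M - ?A = (\<Union>j\<in>UNIV. space M - ?B j)" by auto
      also have "prob \<dots> \<le> (\<Sum>j\<in>UNIV. prob (space M - ?B j))"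
        by (rule finite_measure_subadditive_finite) auto
      also have "\<dots> = (\<Sum>j\<in>UNIV. 1 - prob (?B j))"
        by (intro sum.cong refl prob_compl) measurable
      finally show "1 - (\<Sum>j\<in>UNIV. 1 - prob (?B j)) \<le> joint_cdf M W (\<lambda>_. t)"
        by (simp add: joint_cdf_def)
    qed
    show "\<forall>\<^sub>F t in at_top. joint_cdf M W (\<lambda>_. t) \<le> 1"
      by (simp add: joint_cdf_def)
  qed
qed

lemma marginal_joint_cdf:
  fixes W :: "'a \<Rightarrow> 'd::finite \<Rightarrow> real"
  assumes W: "W \<in> measurable M vec_borel"
  shows "marginal A (joint_cdf M W) x = prob {\<omega> \<in> space M. \<forall>j\<in>A. W \<omega> j \<le> x j}"
proof (rule marginal_eq_limit)
  let ?P = "{\<omega> \<in> space M. \<forall>j\<in>A. W \<omega> j \<le> x j}"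
  let ?Q = "\<lambda>t. {\<omega> \<in> space M. \<forall>j\<in>UNIV. W \<omega> j \<le> t}"
  let ?R = "\<lambda>t. {\<omega> \<in> space M. \<forall>j\<in>UNIV. W \<omega> j \<le> (if j \<in> A then x j else t)}"
  have meas: "?P \<in> events" "?Q t \<in> events" "?R t \<in> events" for t
    using joint_cdf_event[OF W, of A x "{}"] joint_cdf_event[OF W, of UNIV "\<lambda>_. t" "{}"]
      joint_cdf_event[OF W, of UNIV "\<lambda>j. if j \<in> A then x j else t" "{}"] by auto
  have R: "joint_cdf M W (\<lambda>i. if i \<in> A then x i else t) = prob (?R t)" for t
    by (simp add: joint_cdf_def)
  have "((\<lambda>t. prob ?P - (1 - joint_cdf M W (\<lambda>_. t))) \<longlongrightarrow> prob ?P - (1 - 1)) at_top"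
    by (intro tendsto_intros weak_df_diagonal[OF weak_df_joint_cdf[OF W]])
  then have lower: "((\<lambda>t. prob ?P - (1 - joint_cdf M W (\<lambda>_. t))) \<longlongrightarrow> prob ?P) at_top"
    by simp
  show "((\<lambda>t. joint_cdf M W (\<lambda>i. if i \<in> A then x i else t)) \<longlongrightarrow> prob ?P) at_top"
  proof (rule tendsto_sandwich[OF _ _ lower tendsto_const])
    have "prob ?P - (1 - joint_cdf M W (\<lambda>_. t)) \<le> prob (?R t)" for t
    proof -
      have "prob ?P \<le> prob (?R t \<union> (space M - ?Q t))"
        using meas by (intro finite_measure_mono) auto
      also have "\<dots> \<le> prob (?R t) + prob (space M - ?Q t)"
        using meas by (intro measure_Un_le) auto
      also have "prob (space M - ?Q t) = 1 - joint_cdf M W (\<lambda>_. t)"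
        using meas(2)[of t] by (subst prob_compl) (auto simp: joint_cdf_def)
      finally show ?thesis by simp
    qed
    then show "\<forall>\<^sub>F t in at_top. prob ?P - (1 - joint_cdf M W (\<lambda>_. t)) \<le> joint_cdf M W (\<lambda>i. if i \<in> A then x i else t)"
      by (simp add: R)
    have "prob (?R t) \<le> prob ?P" for t
      using meas by (intro finite_measure_mono) auto
    then show "\<forall>\<^sub>F t in at_top. joint_cdf M W (\<lambda>i. if i \<in> A then x i else t) \<le> prob ?P"
      by (simp add: R)
  qed
qed

section \<open>Maxima of a stationary sequence\<close>

lemma comp_max_le_iff:
  "1 \<le> n \<Longrightarrow> comp_max n w j \<le> t \<longleftrightarrow> (\<forall>i<n. w i j \<le> t)"
  unfolding comp_max_def by (subst Max_le_iff) (auto simp: lessThan_empty_iff)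

lemma measurable_comp_max:
  fixes X :: "nat \<Rightarrow> 'a \<Rightarrow> 'd::finite \<Rightarrow> real"
  assumes X: "\<And>i. X i \<in> measurable M vec_borel" and n: "1 \<le> n"
  shows "(\<lambda>\<omega>. comp_max n (\<lambda>i. X i \<omega>)) \<in> measurable M vec_borel"
proof -
  have [measurable]: "(\<lambda>\<omega>. X i \<omega> j) \<in> borel_measurable M" for i j
    by (rule measurable_coordinate[OF X])
  have "(\<lambda>\<omega>. comp_max n (\<lambda>i. X i \<omega>) j) \<in> borel_measurable M" for j
    unfolding borel_measurable_iff_le comp_max_le_iff[OF n] by measurable
  then show ?thesis
    by (intro measurable_PiM_single') auto
qed

lemma stationary_marginal:
  fixes X :: "nat \<Rightarrow> 'a \<Rightarrow> 'd::finite \<Rightarrow> real"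
  assumes X: "stationary M X"
  shows "prob {\<omega> \<in> space M. X i \<omega> j \<le> t} = prob {\<omega> \<in> space M. X 0 \<omega> j \<le> t}"
proof -
  have meas: "X n \<in> measurable M vec_borel" for n
    using X by (auto simp: stationary_def)
  have shift: "(\<lambda>\<omega> n. X (n + k) \<omega>) \<in> measurable M seq_borel" for k
    using meas by (intro measurable_PiM_single') (auto simp: space_PiM)
  let ?S = "{w \<in> space seq_borel. w 0 j \<le> t}"
  have S: "?S \<in> sets seq_borel"
  proof -
    have "(\<lambda>w. w 0) \<in> measurable seq_borel vec_borel"
      by (rule measurable_component_singleton) simp
    from measurable_compose[OF this measurable_component_singleton[of j]]
    have [measurable]: "(\<lambda>w. w 0 j) \<in> borel_measurable seq_borel" by simp
    show ?thesis by measurable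
  qed
  have "measure (distr M seq_borel (\<lambda>\<omega> n. X (n + k) \<omega>)) ?S = prob {\<omega> \<in> space M. X k \<omega> j \<le> t}" for k
    by (subst measure_distr[OF shift S]) (auto intro!: arg_cong[where f = prob] simp: space_PiM)
  from this[of i] this[of 0] show ?thesis
    using X by (simp add: stationary_def)
qed

text \<open>
  Changing the level moves the distribution of the maximum of \<open>n\<close> terms by at most \<open>n\<close> times the
  change in the marginals: a union bound, valid whatever the dependence between the terms.
\<close>

lemma joint_cdf_comp_max_diff:
  fixes X :: "nat \<Rightarrow> 'a \<Rightarrow> 'd::finite \<Rightarrow> real"
  assumes X: "stationary M X" and n: "1 \<le> n"
  defines "K \<equiv> joint_cdf M (\<lambda>\<omega>. comp_max n (\<lambda>i. X i \<omega>))" and "F \<equiv> joint_cdf M (X 0)"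
  shows "\<bar>K x - K y\<bar> \<le> (\<Sum>j\<in>UNIV. real n * \<bar>marginal {j} F x - marginal {j} F y\<bar>)"
proof -
  have meas: "X n \<in> measurable M vec_borel" for n
    using X by (auto simp: stationary_def)
  have [measurable]: "(\<lambda>\<omega>. X i \<omega> j) \<in> borel_measurable M" for i j
    by (rule measurable_coordinate[OF meas])
  note max_meas = measurable_comp_max[OF meas n]
  let ?p = "\<lambda>j t. prob {\<omega> \<in> space M. X 0 \<omega> j \<le> t}"
  let ?q = "\<lambda>j t. prob {\<omega> \<in> space M. \<forall>i<n. X i \<omega> j \<le> t}"
  have q: "marginal {j} K x = ?q j (x j)" for j x
    unfolding K_def using n by (simp add: marginal_joint_cdf[OF max_meas] comp_max_le_iff)
  have p: "marginal {j} F x = ?p j (x j)" for j x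
    unfolding F_def by (simp add: marginal_joint_cdf[OF meas])
  have mono: "?q j s \<le> ?q j t" "?p j s \<le> ?p j t" if "s \<le> t" for j s t
    using that by (auto intro!: finite_measure_mono)
  have le: "?q j t - ?q j s \<le> real n * (?p j t - ?p j s)" if "s \<le> t" for j s t
  proof -
    have "?q j t - ?q j s = prob ({\<omega> \<in> space M. \<forall>i<n. X i \<omega> j \<le> t} - {\<omega> \<in> space M. \<forall>i<n. X i \<omega> j \<le> s})"
      using that by (subst finite_measure_Diff) auto
    also have "\<dots> \<le> prob (\<Union>i<n. {\<omega> \<in> space M. X i \<omega> j \<le> t} - {\<omega> \<in> space M. X i \<omega> j \<le> s})"
      by (rule finite_measure_mono) auto
    also have "\<dots> \<le> (\<Sum>i<n. prob ({\<omega> \<in> space M. X i \<omega> j \<le> t} - {\<omega> \<in> space M. X i \<omega> j \<le> s}))"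
      by (rule finite_measure_subadditive_finite) auto
    also have "\<dots> = (\<Sum>i<n. ?p j t - ?p j s)"
    proof (rule sum.cong[OF refl])
      fix i
      have "prob ({\<omega> \<in> space M. X i \<omega> j \<le> t} - {\<omega> \<in> space M. X i \<omega> j \<le> s})
          = prob {\<omega> \<in> space M. X i \<omega> j \<le> t} - prob {\<omega> \<in> space M. X i \<omega> j \<le> s}"
        using that by (subst finite_measure_Diff) auto
      then show "prob ({\<omega> \<in> space M. X i \<omega> j \<le> t} - {\<omega> \<in> space M. X i \<omega> j \<le> s}) = ?p j t - ?p j s"
        using stationary_marginal[OF X, of i] by simp
    qed
    finally show ?thesis by simp
  qed
  have "\<bar>K x - K y\<bar> \<le> (\<Sum>j\<in>UNIV. \<bar>marginal {j} K x - marginal {j} K y\<bar>)"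
    unfolding K_def by (rule weak_df_lipschitz[OF weak_df_joint_cdf[OF max_meas]])
  also have "\<dots> \<le> (\<Sum>j\<in>UNIV. real n * \<bar>marginal {j} F x - marginal {j} F y\<bar>)"
  proof (rule sum_mono)
    fix j
    show "\<bar>marginal {j} K x - marginal {j} K y\<bar> \<le> real n * \<bar>marginal {j} F x - marginal {j} F y\<bar>"
      unfolding p q using le[of "x j" "y j" j] le[of "y j" "x j" j] mono[of "x j" "y j" j] mono[of "y j" "x j" j]
      by (cases "x j \<le> y j") (auto simp: abs_minus_commute)
  qed
  finally show ?thesis .
qed

lemma iid_comp_max:
  fixes W :: "'a \<Rightarrow> 'd::finite \<Rightarrow> real"
  assumes W: "W \<in> measurable M vec_borel" and n: "1 \<le> n"
  defines "N \<equiv> PiM {..<n} (\<lambda>_. distr M vec_borel W)"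
  shows "measure N {w \<in> space N. \<forall>j. comp_max n w j \<le> u j} = joint_cdf M W u ^ n"
proof -
  interpret D: prob_space "distr M vec_borel W"
    by (rule prob_space_distr[OF W])
  interpret P: finite_product_prob_space "\<lambda>_. distr M vec_borel W" "{..<n}"
    by unfold_locales auto
  let ?B = "{v \<in> space vec_borel. \<forall>j\<in>UNIV. v j \<le> u j}"
  have B: "?B \<in> sets vec_borel"
  proof -
    have [measurable]: "(\<lambda>v. v j) \<in> borel_measurable vec_borel" for j :: 'd
      by (rule measurable_component_singleton) simp
    show ?thesis by measurable
  qed
  have "{w \<in> space N. \<forall>j. comp_max n w j \<le> u j} = (\<Pi>\<^sub>E i\<in>{..<n}. ?B)"
    using n by (auto simp: N_def space_PiM comp_max_le_iff PiE_iff extensional_def)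
  then have "measure N {w \<in> space N. \<forall>j. comp_max n w j \<le> u j} = (\<Prod>i<n. measure (distr M vec_borel W) ?B)"
    unfolding N_def using P.prob_times[of "\<lambda>_. ?B"] B by simp
  also have "measure (distr M vec_borel W) ?B = joint_cdf M W u"
    unfolding joint_cdf_def
    by (subst measure_distr[OF W B]) (auto intro!: arg_cong[where f = prob] simp: space_PiM)
  finally show ?thesis by simp
qed

end

section \<open>The limit distribution of the maxima\<close>

text \<open>
  For a stationary sequence with extremal index \<open>\<theta>\<close> and unit Frechet marginals, attracted to \<open>G\<close>,
  this is the limit law of the normalised maxima \<open>M\<^sub>n / n\<close>.
\<close>

definition index_limit :: "(('d::finite \<Rightarrow> real) \<Rightarrow> real) \<Rightarrow> (('d \<Rightarrow> real) \<Rightarrow> real) \<Rightarrow> ('d \<Rightarrow> real) \<Rightarrow> real" where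
  "index_limit \<theta> G x = (if \<forall>j. 0 < x j then G x powr \<theta> (\<lambda>j. 1 / x j) else 0)"

text \<open>
  The levels \<open>n * x j\<close> correspond to \<open>\<tau> j = 1 / x j\<close>.
\<close>

lemma unit_frechet_level:
  assumes "0 < x"
  shows "(\<lambda>n. real n * (1 - unit_frechet (real n * x))) \<longlonglongrightarrow> 1 / x"
proof -
  have "(\<lambda>n. real n * (1 - exp (- 1 / (real n * x)))) \<longlonglongrightarrow> inverse x"
    using assms by real_asymp
  moreover have "\<forall>\<^sub>F n in sequentially. real n * (1 - exp (- 1 / (real n * x)))
      = real n * (1 - unit_frechet (real n * x))"
    using eventually_gt_at_top[of 0] by eventually_elim (use assms in \<open>simp add: unit_frechet_def\<close>)
  ultimately show ?thesis
    unfolding inverse_eq_divide by (rule Lim_transform_eventually)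
qed

lemma weak_df_limit:
  fixes L :: "('d::finite \<Rightarrow> real) \<Rightarrow> real"
  assumes lim: "\<And>x. (\<lambda>n. K n x) \<longlonglongrightarrow> L x"
    and K: "\<And>n. 1 \<le> n \<Longrightarrow> weak_df UNIV (K n)"
    and top: "((\<lambda>t. L (\<lambda>_. t)) \<longlongrightarrow> 1) at_top"
  shows "weak_df UNIV L"
proof (rule weak_dfI)
  show "L x = L y" if "\<And>i. i \<in> UNIV \<Longrightarrow> x i = y i" for x y
    using that by (auto intro: arg_cong[where f = L])
  fix J and a b :: "'d \<Rightarrow> real" assume "\<And>i. i \<in> J \<Longrightarrow> a i \<le> b i"
  then have "\<forall>n\<ge>1. 0 \<le> box_volume J (K n) a b"
    using weak_df_box[OF K] by blast
  moreover have "(\<lambda>n. box_volume J (K n) a b) \<longlonglongrightarrow> box_volume J L a b"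
    by (intro tendsto_box_volume lim)
  ultimately show "0 \<le> box_volume J L a b"
    by (meson LIMSEQ_le_const)
qed (rule top)

context prob_space
begin

text \<open>
  Attraction is a statement about copulas; by Sklar's theorem, and since the unit Frechet law \<open>\<Phi>\<close>
  satisfies \<open>\<Phi> x powr (1 / n) = \<Phi> (n * x)\<close>, it becomes one about the distribution
  functions.
\<close>

lemma domain_of_attraction_power_limit:
  fixes W :: "'a \<Rightarrow> 'd::finite \<Rightarrow> real"
  assumes W: "W \<in> measurable M vec_borel" and margins: "unit_frechet_marginals (joint_cdf M W)"
    and G: "frechet_mev UNIV (\<lambda>_. 1) (\<lambda>_. 1) G"
    and attracted: "in_domain_of_attraction (joint_cdf M W) G"
    and x: "\<And>j. 0 < x j"
  shows "(\<lambda>n. joint_cdf M W (\<lambda>j. real n * x j) ^ n) \<longlonglongrightarrow> G x"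
proof -
  let ?F = "joint_cdf M W"
  note F = weak_df_joint_cdf[OF W]
  have margin: "marginal {i} ?F x = frechet 1 1 (x i)" for i x
    using margins by (simp add: unit_frechet_marginals_def frechet_unit)
  have sklar_F: "?F x = copula_of UNIV ?F (\<lambda>i. unit_frechet (x i))" for x
  proof -
    have "is_copula_of UNIV ?F (copula_of UNIV ?F)"
      by (rule sklar_continuous[OF F]) (simp_all add: margin continuous_on_frechet frechet_at_bot)
    then show ?thesis by (simp add: is_copula_of_def margin frechet_unit)
  qed
  have sklar_G: "G x = copula_of UNIV G (\<lambda>i. unit_frechet (x i))"
    using frechet_mev_copula[OF G] frechet_mevD(4)[OF G] by (simp add: is_copula_of_def frechet_unit)
  have "(\<lambda>n. copula_of UNIV ?F (\<lambda>j. unit_frechet (x j) powr (1 / real n)) ^ n) \<longlonglongrightarrow> G x"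
    using attracted unfolding in_domain_of_attraction_def sklar_G by (auto simp: unit_frechet_def)
  moreover have "\<forall>\<^sub>F n in sequentially. copula_of UNIV ?F (\<lambda>j. unit_frechet (x j) powr (1 / real n)) ^ n
      = ?F (\<lambda>j. real n * x j) ^ n"
    using eventually_gt_at_top[of 0]
  proof eventually_elim
    case (elim n)
    have "unit_frechet (x j) powr (1 / real n) = unit_frechet (real n * x j)" for j
      using x[of j] elim by (simp add: unit_frechet_def powr_def)
    then show ?case by (simp add: sklar_F[of "\<lambda>j. real n * x j"])
  qed
  ultimately show ?thesis by (rule Lim_transform_eventually)
qed

text \<open>
  The extremal index only provides the limit along some levels \<open>u n\<close>. Any two sequences of levels
  with the same \<open>\<tau>\<close> have marginal tails that differ by \<open>o(1 / n)\<close>, and the union bound shows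
  that this is negligible, both for the stationary sequence and for independent copies. The latter
  identifies the limit \<open>\<gamma>\<close> as \<open>G x\<close>. Outside the open orthant the marginals already vanish.
\<close>

lemma comp_max_limit:
  fixes X :: "nat \<Rightarrow> 'a \<Rightarrow> 'd::finite \<Rightarrow> real"
  assumes X: "stationary M X" and margins: "unit_frechet_marginals (joint_cdf M (X 0))"
    and G: "frechet_mev UNIV (\<lambda>_. 1) (\<lambda>_. 1) G"
    and attracted: "in_domain_of_attraction (joint_cdf M (X 0)) G"
    and index: "has_extremal_index M X \<theta>"
  shows "(\<lambda>n. joint_cdf M (\<lambda>\<omega>. comp_max n (\<lambda>i. X i \<omega>)) (\<lambda>j. real n * x j)) \<longlonglongrightarrow> index_limit \<theta> G x"
proof -
  have meas: "X n \<in> measurable M vec_borel" for n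
    using X by (auto simp: stationary_def)
  let ?F = "joint_cdf M (X 0)" and ?K = "\<lambda>n. joint_cdf M (\<lambda>\<omega>. comp_max n (\<lambda>i. X i \<omega>))"
  note F = weak_df_joint_cdf[OF meas[of 0]]
  have margin: "marginal {j} ?F x = unit_frechet (x j)" for j x
    using margins by (simp add: unit_frechet_marginals_def)
  have margin': "prob {\<omega> \<in> space M. X 0 \<omega> j \<le> t} = unit_frechet t" for j t
    using marginal_joint_cdf[OF meas[of 0], of "{j}" "\<lambda>_. t"] margin by simp
  show ?thesis
  proof (cases "\<forall>j. 0 < x j")
    case False
    then obtain j where j: "x j \<le> 0" by (auto simp: not_less)
    have "?K n (\<lambda>j. real n * x j) = 0" if n: "1 \<le> n" for n
    proof -
      have "?K n (\<lambda>j. real n * x j) \<le> prob {\<omega> \<in> space M. X 0 \<omega> j \<le> real n * x j}"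
        unfolding joint_cdf_def using n measurable_coordinate[OF meas, of 0 j]
        by (intro finite_measure_mono) (auto simp: comp_max_le_iff)
      also have "\<dots> = 0"
        using j by (simp add: margin' unit_frechet_def zero_less_mult_iff)
      finally show ?thesis
        by (simp add: joint_cdf_def measure_le_0_iff)
    qed
    then have "\<forall>\<^sub>F n in sequentially. ?K n (\<lambda>j. real n * x j) = 0"
      using eventually_ge_at_top[of 1] by (rule eventually_mono[rotated])
    moreover have "index_limit \<theta> G x = 0"
      using False unfolding index_limit_def by (rule if_not_P)
    ultimately show ?thesis
      by (simp only: tendsto_eventually)
  next
    case True
    then have x: "0 < x j" for j by simp
    let ?\<tau> = "\<lambda>j. 1 / x j"
    let ?N = "\<lambda>n. PiM {..<n} (\<lambda>_. distr M vec_borel (X 0))"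
    obtain u \<gamma> where level: "\<And>j. (\<lambda>n. real n * (1 - measure M {\<omega> \<in> space M. X 0 \<omega> j \<le> u n j})) \<longlonglongrightarrow> ?\<tau> j"
      and iid_lim: "(\<lambda>n. measure (?N n) {w \<in> space (?N n). \<forall>j. comp_max n w j \<le> u n j}) \<longlonglongrightarrow> \<gamma>"
      and max_lim: "(\<lambda>n. measure M {\<omega> \<in> space M. \<forall>j. comp_max n (\<lambda>i. X i \<omega>) j \<le> u n j}) \<longlonglongrightarrow> \<gamma> powr \<theta> ?\<tau>"
      using index[unfolded has_extremal_index_def Let_def, rule_format, of ?\<tau>] x by auto
    have "(\<lambda>n. real n * (1 - unit_frechet (real n * x j)) - real n * (1 - unit_frechet (u n j)))
        \<longlonglongrightarrow> ?\<tau> j - ?\<tau> j" for j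
      using level[of j] by (intro tendsto_diff unit_frechet_level[OF x]) (simp add: margin')
    then have "(\<lambda>n. real n * (unit_frechet (u n j) - unit_frechet (real n * x j))) \<longlonglongrightarrow> 0" for j
      by (simp add: algebra_simps)
    from tendsto_rabs_zero[OF this]
    have gap: "(\<lambda>n. \<Sum>j\<in>UNIV. real n * \<bar>unit_frechet (u n j) - unit_frechet (real n * x j)\<bar>) \<longlonglongrightarrow> 0"
      by (intro tendsto_null_sum) (simp add: abs_mult)
    have "(\<lambda>n. ?F (u n) ^ n - ?F (\<lambda>j. real n * x j) ^ n) \<longlonglongrightarrow> 0"
    proof (rule Lim_null_comparison[OF _ gap], rule always_eventually, rule allI)
      fix n
      have "norm (?F (u n) ^ n - ?F (\<lambda>j. real n * x j) ^ n) \<le> real n * norm (?F (u n) - ?F (\<lambda>j. real n * x j))"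
        by (rule norm_power_diff) (simp_all add: joint_cdf_def)
      also have "\<dots> \<le> real n * (\<Sum>j\<in>UNIV. \<bar>unit_frechet (u n j) - unit_frechet (real n * x j)\<bar>)"
        using weak_df_lipschitz[OF F, of "u n" "\<lambda>j. real n * x j"]
        by (intro mult_left_mono) (auto simp: margin)
      finally show "norm (?F (u n) ^ n - ?F (\<lambda>j. real n * x j) ^ n)
          \<le> (\<Sum>j\<in>UNIV. real n * \<bar>unit_frechet (u n j) - unit_frechet (real n * x j)\<bar>)"
        by (simp add: sum_distrib_left)
    qed
    from tendsto_add[OF this domain_of_attraction_power_limit[where x = x, OF meas margins G attracted x]]
    have "(\<lambda>n. ?F (u n) ^ n) \<longlonglongrightarrow> G x" by simp
    moreover have "\<forall>\<^sub>F n in sequentially. measure (?N n) {w \<in> space (?N n). \<forall>j. comp_max n w j \<le> u n j} = ?F (u n) ^ n"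
      using eventually_ge_at_top[of 1] by eventually_elim (rule iid_comp_max[OF meas])
    from Lim_transform_eventually[OF iid_lim this] have "(\<lambda>n. ?F (u n) ^ n) \<longlonglongrightarrow> \<gamma>" .
    ultimately have \<gamma>: "\<gamma> = G x"
      using LIMSEQ_unique by blast
    have "(\<lambda>n. ?K n (\<lambda>j. real n * x j) - ?K n (u n)) \<longlonglongrightarrow> 0"
    proof (rule Lim_null_comparison[OF _ gap])
      show "\<forall>\<^sub>F n in sequentially. norm (?K n (\<lambda>j. real n * x j) - ?K n (u n))
          \<le> (\<Sum>j\<in>UNIV. real n * \<bar>unit_frechet (u n j) - unit_frechet (real n * x j)\<bar>)"
        using eventually_ge_at_top[of 1]
      proof eventually_elim
        case (elim n)
        show ?case
          using joint_cdf_comp_max_diff[OF X elim, of "u n" "\<lambda>j. real n * x j"]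
          by (simp add: margin abs_minus_commute)
      qed
    qed
    moreover have "(\<lambda>n. ?K n (u n)) \<longlonglongrightarrow> index_limit \<theta> G x"
      using max_lim x by (simp add: joint_cdf_def index_limit_def \<gamma>)
    ultimately show ?thesis
      using tendsto_add[of "\<lambda>n. ?K n (\<lambda>j. real n * x j) - ?K n (u n)" 0 sequentially "\<lambda>n. ?K n (u n)"] by simp
  qed
qed

end

section \<open>Marginals of the limit and the limiting index\<close>

lemma index_limit_ge:
  assumes G: "weak_df UNIV G" and \<theta>: "\<theta> (\<lambda>j. 1 / x j) \<in> {0..1}" and x: "\<And>j. 0 < x j"
  shows "G x \<le> index_limit \<theta> G x"
proof -
  have "G x powr 1 \<le> G x powr \<theta> (\<lambda>j. 1 / x j)"
    using \<theta> weak_df_nonneg[OF G] weak_df_le_1[OF G] by (intro powr_mono') auto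
  then show ?thesis
    using x weak_df_nonneg[OF G, of x] by (simp add: index_limit_def)
qed

text \<open>
  Nonnegative box volumes are inherited from the distribution functions of the maxima: this is
  where the extremal index being that of a process is used, since for an arbitrary \<open>\<theta>\<close> the power
  \<open>G powr \<theta>\<close> need not be a distribution function. As the index is at most 1, the limit dominates
  \<open>G\<close> and hence has total mass 1.
\<close>

lemma weak_df_index_limit:
  fixes G :: "('d::finite \<Rightarrow> real) \<Rightarrow> real"
  assumes G: "weak_df UNIV G"
    and lim: "\<And>x. (\<lambda>n. K n (\<lambda>j. real n * x j)) \<longlonglongrightarrow> index_limit \<theta> G x"
    and K: "\<And>n. 1 \<le> n \<Longrightarrow> weak_df UNIV (K n)"
    and \<theta>: "\<And>\<tau>. (\<And>j. 0 < \<tau> j) \<Longrightarrow> \<theta> \<tau> \<in> {0..1}"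
  shows "weak_df UNIV (index_limit \<theta> G)"
proof (rule weak_df_limit[OF lim])
  show "weak_df UNIV (\<lambda>x. K n (\<lambda>j. real n * x j))" if "1 \<le> n" for n
    using that by (intro weak_df_coordinate_change[OF K[OF that]] filterlim_const_mult_at_top monoI mult_left_mono) auto
  show "((\<lambda>t. index_limit \<theta> G (\<lambda>_. t)) \<longlongrightarrow> 1) at_top"
  proof (rule tendsto_sandwich[OF _ _ weak_df_diagonal[OF G] tendsto_const])
    show "\<forall>\<^sub>F t in at_top. G (\<lambda>_. t) \<le> index_limit \<theta> G (\<lambda>_. t)"
      using eventually_gt_at_top[of 0]
    proof eventually_elim
      case (elim t)
      show ?case
        by (rule index_limit_ge[OF G]) (use \<theta>[of "\<lambda>_. 1 / t"] elim in auto)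
    qed
    show "\<forall>\<^sub>F t in at_top. index_limit \<theta> G (\<lambda>_. t) \<le> 1"
      using eventually_gt_at_top[of 0]
    proof eventually_elim
      case (elim t)
      have "G (\<lambda>_. t) powr \<theta> (\<lambda>_. 1 / t) \<le> 1"
        using \<theta>[of "\<lambda>_. 1 / t"] elim weak_df_nonneg[OF G] weak_df_le_1[OF G]
        by (intro powr_le1) auto
      then show ?case using elim by (simp add: index_limit_def)
    qed
  qed
qed

lemma index_limit_max_stable:
  assumes G: "frechet_mev UNIV (\<lambda>_. 1) (\<lambda>_. 1) G"
    and homogeneous: "\<And>c \<tau>. 0 < c \<Longrightarrow> (\<And>j. 0 < \<tau> j) \<Longrightarrow> \<theta> (\<lambda>j. c * \<tau> j) = \<theta> \<tau>"
    and n: "1 \<le> n"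
  shows "index_limit \<theta> G (\<lambda>i. real n powr (1 / 1) * x i) ^ n = index_limit \<theta> G x"
proof (cases "\<forall>j. 0 < x j")
  case True
  have "\<theta> (\<lambda>j. 1 / (real n * x j)) = \<theta> (\<lambda>j. 1 / real n * (1 / x j))"
    by (rule arg_cong[where f = \<theta>]) auto
  also have "\<dots> = \<theta> (\<lambda>j. 1 / x j)"
    using n True by (intro homogeneous) auto
  finally have \<theta>: "\<theta> (\<lambda>j. 1 / (real n * x j)) = \<theta> (\<lambda>j. 1 / x j)" .
  have pos: "0 < G (\<lambda>j. real n * x j)"
    using n True by (intro frechet_mev_pos[OF G]) auto
  have "(G (\<lambda>j. real n * x j) powr t) ^ n = (G (\<lambda>j. real n * x j) ^ n) powr t" for t
    using pos by (simp add: powr_realpow[symmetric] powr_powr mult.commute)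
  then show ?thesis
    using frechet_mevD(5)[OF G n, of x] n True by (simp add: index_limit_def \<theta>)
next
  case False
  then obtain j where "\<not> 0 < x j" by auto
  then have "\<not> 0 < real n * x j" by (simp add: zero_less_mult_iff)
  then have "index_limit \<theta> G (\<lambda>i. real n * x i) = 0" "index_limit \<theta> G x = 0"
    using \<open>\<not> 0 < x j\<close> unfolding index_limit_def by (metis (mono_tags, lifting))+
  with n show ?thesis by simp
qed

text \<open>
  On the open orthant \<open>\<theta> (1 / x) = ln (index_limit \<theta> G x) / ln (G x)\<close>, and both
  functions converge to their marginals, so the quotient converges as soon as the limit of the
  denominator is not 0. The latter needs \<open>A\<close> nonempty: for \<open>A = {}\<close> the quotient tends to
  \<open>0 / 0\<close>. An arbitrary filter is allowed so that the limit can be evaluated along a path.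
\<close>

lemma tendsto_index:
  fixes \<sigma> :: "'b \<Rightarrow> 'd::finite \<Rightarrow> real"
  assumes G: "frechet_mev UNIV (\<lambda>_. 1) (\<lambda>_. 1) G" and L: "weak_df UNIV (index_limit \<theta> G)"
    and \<theta>: "\<And>\<tau>. (\<And>j. 0 < \<tau> j) \<Longrightarrow> \<theta> \<tau> \<in> {0..1}"
    and A: "A \<noteq> {}" and x: "\<And>j. 0 < x j"
    and \<sigma>: "\<And>j. filterlim (\<lambda>s. \<sigma> s j) (at_right 0) Fl"
  shows "((\<lambda>s. \<theta> (\<lambda>j. if j \<in> A then 1 / x j else \<sigma> s j))
    \<longlongrightarrow> ln (marginal A (index_limit \<theta> G) x) / ln (marginal A G x)) Fl"
    and "0 < marginal A (index_limit \<theta> G) x" and "0 < marginal A G x" and "marginal A G x < 1"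
proof -
  let ?L = "index_limit \<theta> G"
  note GD = frechet_mevD[OF G]
  have ge: "G y \<le> ?L y" if "\<And>j. 0 < y j" for y
    by (rule index_limit_ge[OF GD(1)]) (use \<theta> that in auto)
  show G_pos: "0 < marginal A G x"
    using frechet_mev_pos[OF frechet_mev_marginal[OF G subset_UNIV]] x by blast
  show L_pos: "0 < marginal A ?L x"
  proof (rule less_le_trans[OF G_pos], rule tendsto_le)
    show "\<forall>\<^sub>F t in at_top. G (\<lambda>i. if i \<in> A then x i else t) \<le> ?L (\<lambda>i. if i \<in> A then x i else t)"
      using eventually_gt_at_top[of 0] by eventually_elim (rule ge, use x in auto)
  qed (use tendsto_marginal_diagonal[OF GD(1)] tendsto_marginal_diagonal[OF L] in auto)
  obtain k where k: "k \<in> A" using A by auto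
  have margin_lt: "G y < 1" if "y k = x k" for y
    using weak_df_le_marginal[OF GD(1), of y "{k}"] GD(4)[of k y] x[of k] that
    by (simp add: frechet_def powr_minus_divide) (smt (verit) exp_less_one_iff divide_pos_pos)
  show G_lt: "marginal A G x < 1"
  proof -
    have "marginal A G x \<le> marginal {k} (marginal A G) x"
      by (rule weak_df_le_marginal[OF weak_df_marginal[OF GD(1)]])
    also have "\<dots> = frechet 1 1 (x k)"
      using k by (simp add: marginal_marginal[OF GD(1)] GD(4))
    also have "\<dots> < 1"
      using x[of k] by (simp add: frechet_def)
    finally show ?thesis .
  qed
  let ?z = "\<lambda>s j. 1 / \<sigma> s j"
  let ?y = "\<lambda>s j. if j \<in> A then x j else ?z s j"
  have z: "filterlim (\<lambda>s. ?z s j) at_top Fl" for j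
    using filterlim_compose[OF filterlim_inverse_at_top_right \<sigma>[of j]] by (simp add: inverse_eq_divide)
  have "((\<lambda>s. ln (?L (?y s)) / ln (G (?y s))) \<longlongrightarrow> ln (marginal A ?L x) / ln (marginal A G x)) Fl"
    using L_pos G_pos G_lt
    by (intro tendsto_divide tendsto_ln tendsto_marginal[OF L] tendsto_marginal[OF GD(1)] z) auto
  moreover have "\<forall>\<^sub>F s in Fl. ln (?L (?y s)) / ln (G (?y s)) = \<theta> (\<lambda>j. if j \<in> A then 1 / x j else \<sigma> s j)"
  proof -
    have "\<forall>\<^sub>F s in Fl. 0 < \<sigma> s j" for j
      using \<sigma>[of j] by (auto simp: filterlim_at elim: eventually_mono)
    then have "\<forall>\<^sub>F s in Fl. \<forall>j. 0 < \<sigma> s j"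
      by (rule eventually_all_finite)
    then show ?thesis
    proof eventually_elim
      case (elim s)
      have y: "0 < ?y s j" for j using x elim by auto
      have "(\<lambda>j. 1 / ?y s j) = (\<lambda>j. if j \<in> A then 1 / x j else \<sigma> s j)" by auto
      then have "?L (?y s) = G (?y s) powr \<theta> (\<lambda>j. if j \<in> A then 1 / x j else \<sigma> s j)"
        using y by (simp add: index_limit_def)
      moreover have "0 < G (?y s)"
        by (rule frechet_mev_pos[OF G y])
      moreover have "G (?y s) < 1"
        by (rule margin_lt) (use k in auto)
      ultimately show ?case by (simp add: ln_powr)
    qed
  qed
  ultimately show "((\<lambda>s. \<theta> (\<lambda>j. if j \<in> A then 1 / x j else \<sigma> s j))
      \<longlongrightarrow> ln (marginal A ?L x) / ln (marginal A G x)) Fl"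
    by (rule Lim_transform_eventually)
qed

lemma filterlim_diagonal_at_zero:
  "filterlim (\<lambda>e (_ :: 'd::finite). e) (at (\<lambda>_. 0) within {s. \<forall>j. 0 < s j}) (at_right (0::real))"
  unfolding filterlim_at
proof
  have "continuous_on UNIV (\<lambda>(e::real) (_ :: 'd). e)"
    by (intro continuous_on_coordinatewise_then_product continuous_intros)
  then have "isCont (\<lambda>(e::real) (_ :: 'd). e) 0"
    by (simp add: continuous_on_eq_continuous_at)
  then show "((\<lambda>(e::real) (_ :: 'd). e) \<longlongrightarrow> (\<lambda>_. 0)) (at_right 0)"
    by (simp add: isCont_def filterlim_at_split)
  show "\<forall>\<^sub>F e in at_right (0::real). (\<lambda>_ :: 'd. e) \<in> {s. \<forall>j. 0 < s j} \<and> (\<lambda>_ :: 'd. e) \<noteq> (\<lambda>_. 0)"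
    using eventually_at_right_less[of 0] by eventually_elim (auto simp: fun_eq_iff)
qed

lemma filterlim_coordinate_at_zero:
  "filterlim (\<lambda>s. s j) (at_right (0::real)) (at (\<lambda>_. 0) within {s. \<forall>j::'d::finite. 0 < s j})"
  unfolding filterlim_at
proof
  have "continuous_on UNIV (\<lambda>s :: 'd \<Rightarrow> real. s j)"
    by (rule continuous_on_product_coordinates)
  then have "isCont (\<lambda>s :: 'd \<Rightarrow> real. s j) (\<lambda>_. 0)"
    using continuous_on_eq_continuous_at[OF open_UNIV] by blast
  then show "((\<lambda>s :: 'd \<Rightarrow> real. s j) \<longlongrightarrow> 0) (at (\<lambda>_. 0) within {s. \<forall>j. 0 < s j})"
    by (auto simp: isCont_def intro: tendsto_within_subset)
  show "\<forall>\<^sub>F s in at (\<lambda>_. 0) within {s. \<forall>j. 0 < s j}. s j \<in> {0<..} \<and> s j \<noteq> (0::real)"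
    unfolding eventually_at_filter by (rule always_eventually) (auto dest: spec[of _ j])
qed

lemma sub_index_eq:
  fixes G :: "('d::finite \<Rightarrow> real) \<Rightarrow> real"
  assumes "frechet_mev UNIV (\<lambda>_. 1) (\<lambda>_. 1) G" "weak_df UNIV (index_limit \<theta> G)"
    "\<And>\<tau>. (\<And>j. 0 < \<tau> j) \<Longrightarrow> \<theta> \<tau> \<in> {0..1}"
    "A \<noteq> {}" "\<And>j. 0 < x j"
  shows "sub_index \<theta> A (\<lambda>j. 1 / x j) = ln (marginal A (index_limit \<theta> G) x) / ln (marginal A G x)"
  unfolding sub_index_def
proof (rule tendsto_Lim)
  show "((\<lambda>s. \<theta> (\<lambda>j. if j \<in> A then 1 / x j else s j))
    \<longlongrightarrow> ln (marginal A (index_limit \<theta> G) x) / ln (marginal A G x)) (at (\<lambda>_. 0) within {s. \<forall>j. 0 < s j})"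
    by (rule tendsto_index(1)[OF assms filterlim_coordinate_at_zero])
  show "at (\<lambda>_ :: 'd. 0 :: real) within {s. \<forall>j. 0 < s j} \<noteq> bot"
    using filterlim_diagonal_at_zero[where 'd = 'd] by (auto simp: filterlim_def filtermap_bot_iff bot_unique)
qed

text \<open>
  For \<open>A = {}\<close> the limiting index may be meaningless, but it is the exponent of the base 1.
\<close>

lemma marginal_powr_sub_index:
  fixes G :: "('d::finite \<Rightarrow> real) \<Rightarrow> real"
  assumes G: "frechet_mev UNIV (\<lambda>_. 1) (\<lambda>_. 1) G" and L: "weak_df UNIV (index_limit \<theta> G)"
    and \<theta>: "\<And>\<tau>. (\<And>j. 0 < \<tau> j) \<Longrightarrow> \<theta> \<tau> \<in> {0..1}" and x: "\<And>j. 0 < x j"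
  shows "marginal A G x powr sub_index \<theta> A (\<lambda>j. 1 / x j) = marginal A (index_limit \<theta> G) x"
proof (cases "A = {}")
  case True
  then show ?thesis
    by (simp add: marginal_empty[OF L] marginal_empty[OF frechet_mevD(1)[OF G]])
next
  case False
  note facts = tendsto_index(2-4)[where x = x, OF G L \<theta> False x filterlim_coordinate_at_zero]
  show ?thesis
    using facts sub_index_eq[where x = x and \<theta> = \<theta>, OF G L \<theta> False x] by (simp add: powr_def)
qed

text \<open>
  Homogeneity of \<open>\<theta>\<close> passes to its limits: evaluate both along the diagonal path to 0, one at
  speed \<open>c\<close>.
\<close>

lemma sub_index_const:
  fixes G :: "('d::finite \<Rightarrow> real) \<Rightarrow> real"
  assumes G: "frechet_mev UNIV (\<lambda>_. 1) (\<lambda>_. 1) G" and L: "weak_df UNIV (index_limit \<theta> G)"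
    and \<theta>: "\<And>\<tau>. (\<And>j. 0 < \<tau> j) \<Longrightarrow> \<theta> \<tau> \<in> {0..1}"
    and homogeneous: "\<And>c \<tau>. 0 < c \<Longrightarrow> (\<And>j. 0 < \<tau> j) \<Longrightarrow> \<theta> (\<lambda>j. c * \<tau> j) = \<theta> \<tau>"
    and A: "A \<noteq> {}" and c: "0 < c"
  shows "sub_index \<theta> A (\<lambda>_. c) = sub_index \<theta> A (\<lambda>_. 1)"
proof -
  let ?R = "\<lambda>x. ln (marginal A (index_limit \<theta> G) (\<lambda>_. x)) / ln (marginal A G (\<lambda>_. x))"
  let ?f = "\<lambda>c e. \<theta> (\<lambda>j. if j \<in> A then c else e)"
  have scale: "filterlim (\<lambda>e. c * e) (at_right 0) (at_right (0::real))"
    using c by real_asymp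
  have "((\<lambda>e. ?f (1 / (1 / c)) (c * e)) \<longlongrightarrow> ?R (1 / c)) (at_right 0)"
    by (rule tendsto_index(1)[OF G L \<theta> A, where x = "\<lambda>_. 1 / c"]) (use c scale in auto)
  moreover have "\<forall>\<^sub>F e in at_right 0. ?f (1 / (1 / c)) (c * e) = ?f 1 e"
    using eventually_at_right_less[of 0]
  proof eventually_elim
    case (elim e)
    have "?f (1 / (1 / c)) (c * e) = \<theta> (\<lambda>j. c * (if j \<in> A then 1 else e))"
      by (rule arg_cong[where f = \<theta>]) auto
    also have "\<dots> = ?f 1 e"
      using c elim by (intro homogeneous) auto
    finally show ?case .
  qed
  ultimately have "((\<lambda>e. ?f 1 e) \<longlongrightarrow> ?R (1 / c)) (at_right 0)"
    by (rule Lim_transform_eventually)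
  moreover have "((\<lambda>e. ?f (1 / 1) e) \<longlongrightarrow> ?R 1) (at_right 0)"
    by (rule tendsto_index(1)[OF G L \<theta> A, where x = "\<lambda>_. 1"]) (auto simp: filterlim_ident)
  then have "((\<lambda>e. ?f 1 e) \<longlongrightarrow> ?R 1) (at_right 0)"
    by (simp only: div_by_1)
  ultimately have "?R (1 / c) = ?R 1"
    by (rule tendsto_unique[rotated]) simp
  then show ?thesis
    using sub_index_eq[OF G L \<theta> A, of "\<lambda>_. 1 / c"] sub_index_eq[OF G L \<theta> A, of "\<lambda>_. 1"] c by simp
qed

text \<open>
  Positivity of the marginal indices is what makes the restriction to \<open>A\<close> nondegenerate and lets
  it vanish at the boundary of the orthant; it is why one restricts to \<open>A\<close> first.
\<close>

lemma frechet_mev_index_limit: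
  fixes G :: "('d::finite \<Rightarrow> real) \<Rightarrow> real"
  assumes G: "frechet_mev UNIV (\<lambda>_. 1) (\<lambda>_. 1) G" and L: "weak_df UNIV (index_limit \<theta> G)"
    and \<theta>: "\<And>\<tau>. (\<And>j. 0 < \<tau> j) \<Longrightarrow> \<theta> \<tau> \<in> {0..1}"
    and homogeneous: "\<And>c \<tau>. 0 < c \<Longrightarrow> (\<And>j. 0 < \<tau> j) \<Longrightarrow> \<theta> (\<lambda>j. c * \<tau> j) = \<theta> \<tau>"
    and pos: "\<And>j. j \<in> A \<Longrightarrow> 0 < marginal_index \<theta> j"
  shows "frechet_mev A (marginal_index \<theta>) (\<lambda>_. 1) (marginal A (index_limit \<theta> G))"
proof (rule frechet_mevI)
  let ?L = "index_limit \<theta> G"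
  show "weak_df A (marginal A ?L)" by (rule weak_df_marginal[OF L])
  show "0 < marginal_index \<theta> i" if "i \<in> A" for i by (rule pos[OF that])
  show "marginal A ?L (\<lambda>i. real n powr (1 / 1) * x i) ^ n = marginal A ?L x" if "1 \<le> n" for n x
    by (rule marginal_max_stable[OF L index_limit_max_stable[OF G homogeneous that] that])
  fix i and x :: "'d \<Rightarrow> real" assume i: "i \<in> A"
  have "marginal {i} (marginal A ?L) x = marginal {i} ?L x"
    using i by (intro marginal_marginal[OF L]) auto
  also have "\<dots> = frechet (marginal_index \<theta> i) 1 (x i)"
  proof (cases "0 < x i")
    case True
    have "marginal {i} ?L x = marginal {i} ?L (\<lambda>_. x i)"
      by (rule marginal_cong) simp
    also have "\<dots> = marginal {i} G (\<lambda>_. x i) powr sub_index \<theta> {i} (\<lambda>_. 1 / x i)"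
      using marginal_powr_sub_index[OF G L \<theta>, of "\<lambda>_. x i" "{i}"] True by simp
    also have "sub_index \<theta> {i} (\<lambda>_. 1 / x i) = marginal_index \<theta> i"
      unfolding marginal_index_def using True by (intro sub_index_const[OF G L \<theta> homogeneous]) auto
    finally show ?thesis
      using True by (simp add: frechet_mevD(4)[OF G] frechet_def powr_def)
  next
    case False
    have "?L (\<lambda>j. if j \<in> {i} then x j else t) = 0" for t
      unfolding index_limit_def by (rule if_not_P) (use False in auto)
    then have "marginal {i} ?L x = 0"
      by (intro marginal_eq_limit) simp
    with False show ?thesis by simp
  qed
  finally show "marginal {i} (marginal A ?L) x = frechet (marginal_index \<theta> i) 1 (x i)" .
qed auto

section \<open>The extremal coefficients of the pMAX limits\<close>

theorem proposition2p4:
  fixes M :: "'a measure"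
    and X Z Y :: "nat \<Rightarrow> 'a \<Rightarrow> 'd::finite \<Rightarrow> real"
    and \<alpha> :: "'d \<Rightarrow> real"
    and \<theta> G H V Vhat :: "('d \<Rightarrow> real) \<Rightarrow> real"
    and \<theta>m :: "'d \<Rightarrow> real"
    and U :: "'d set"
  assumes prob: "prob_space M"
    and X_stationary: "stationary M X"
    and X_frechet: "unit_frechet_marginals (joint_cdf M (X 0))"
    and G_mev: "mev UNIV G" "unit_frechet_marginals G"
    and X_attracted: "in_domain_of_attraction (joint_cdf M (X 0)) G"
    and X_index: "has_extremal_index M X \<theta>"
    and index_homogeneous: "\<And>c \<tau>. 0 < c \<Longrightarrow> (\<And>j. 0 < \<tau> j) \<Longrightarrow> \<theta> (\<lambda>j. c * \<tau> j) = \<theta> \<tau>"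
    and Z_iid: "iid M Z"
    and Z_frechet: "unit_frechet_marginals (joint_cdf M (Z 0))"
    and H_mev: "mev UNIV H" "unit_frechet_marginals H"
    and Z_attracted: "in_domain_of_attraction (joint_cdf M (Z 0)) H"
    and XZ_indep: "prob_space.indep_var M seq_borel (\<lambda>\<omega> n. X n \<omega>) seq_borel (\<lambda>\<omega> n. Z n \<omega>)"
    and \<alpha>_pos: "\<And>j. 0 < \<alpha> j"
    and Y_def: "Y = pmax_process \<alpha> X Z"
    and U_def: "U = pmax_U \<alpha>"
    and V_def: "V = pmax_V \<alpha> \<theta> G H"
    and Vhat_def: "Vhat = pmax_Vhat \<alpha> G H"
    and \<theta>m_def: "\<theta>m = marginal_index \<theta>"
    and \<theta>m_pos: "\<And>j. j \<in> U \<Longrightarrow> 0 < \<theta>m j"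
  shows "mev UNIV Vhat \<and> mev UNIV V \<and>
     extremal_coefficient UNIV Vhat
       = extremal_coefficient U (marginal U G) + extremal_coefficient (- U) (marginal (- U) H) \<and>
     extremal_coefficient UNIV V
       = sub_index \<theta> U (\<lambda>j. 1 / \<theta>m j)
           * (- ln (copula_of U (marginal U G) (\<lambda>j. exp (- 1 / \<theta>m j))))
         + extremal_coefficient (- U) (marginal (- U) H)"
proof -
  interpret prob_space M by (rule prob)
  let ?one = "\<lambda>_ :: 'd. 1 :: real"
  have G: "frechet_mev UNIV ?one ?one G" and H: "frechet_mev UNIV ?one ?one H"
    using mev_imp_frechet_mev G_mev H_mev by auto
  have GU: "frechet_mev U ?one ?one (marginal U G)" and HU: "frechet_mev (- U) ?one ?one (marginal (- U) H)"
    by (auto intro: frechet_mev_marginal[OF G] frechet_mev_marginal[OF H])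
  have meas: "X n \<in> measurable M vec_borel" for n
    using X_stationary by (auto simp: stationary_def)
  have \<theta>_range: "\<theta> \<tau> \<in> {0..1}" if "\<And>j. 0 < \<tau> j" for \<tau>
    using X_index that by (auto simp: has_extremal_index_def Let_def)
  let ?L = "index_limit \<theta> G"
  have L: "weak_df UNIV ?L"
  proof (rule weak_df_index_limit[OF frechet_mevD(1)[OF G] _ _ \<theta>_range])
    show "(\<lambda>n. joint_cdf M (\<lambda>\<omega>. comp_max n (\<lambda>i. X i \<omega>)) (\<lambda>j. real n * x j)) \<longlonglongrightarrow> ?L x" for x
      by (rule comp_max_limit[OF X_stationary X_frechet G X_attracted X_index])
    show "weak_df UNIV (joint_cdf M (\<lambda>\<omega>. comp_max n (\<lambda>i. X i \<omega>)))" if "1 \<le> n" for n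
      by (rule weak_df_joint_cdf[OF measurable_comp_max[OF meas that]])
  qed
  have LU: "frechet_mev U \<theta>m ?one (marginal U ?L)"
    unfolding \<theta>m_def
    by (rule frechet_mev_index_limit[OF G L \<theta>_range index_homogeneous]) (use \<theta>m_pos \<theta>m_def in auto)
  \<comment> \<open>on the open orthant, the second factor of both distributions\<close>
  define F where "F x = marginal (- U) H (\<lambda>i. max 0 (x i) powr \<alpha> i)" for x
  have F: "frechet_mev (- U) ?one (\<lambda>i. 1 * \<alpha> i) F"
    unfolding F_def by (rule frechet_mev_powr[OF HU \<alpha>_pos])
  have F_eq: "F x = marginal (- U) H (\<lambda>i. x i powr \<alpha> i)" if "\<forall>j. 0 < x j" for x
    unfolding F_def using that by (intro marginal_cong) (simp add: max_def less_imp_le)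
  have vanish: "K x = 0" if "frechet_mev A c a K" "i \<in> A" "\<not> 0 < x i" for A c a K i and x :: "'d \<Rightarrow> real"
    using weak_df_le_marginal[OF frechet_mevD(1)[OF that(1)], of x "{i}"]
      weak_df_nonneg[OF frechet_mevD(1)[OF that(1)], of x] frechet_mevD(4)[OF that(1,2), of x] that(3)
    by simp
  have Vhat: "Vhat = (\<lambda>x. marginal U G x * F x)"
  proof
    fix x
    show "Vhat x = marginal U G x * F x"
    proof (cases "\<forall>j. 0 < x j")
      case True
      then show ?thesis by (simp add: Vhat_def pmax_Vhat_def U_def[symmetric] F_eq)
    next
      case False
      then obtain j where j: "\<not> 0 < x j" by blast
      have "marginal U G x = 0 \<or> F x = 0"
      proof (cases "j \<in> U")
        case True
        have "marginal U G x = 0"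
          by (rule vanish[OF GU True]) (rule j)
        then show ?thesis ..
      next
        case False
        have "F x = 0"
          by (rule vanish[OF F]) (use False j in auto)
        then show ?thesis ..
      qed
      moreover have "Vhat x = 0"
        unfolding Vhat_def pmax_Vhat_def using False by (rule if_not_P)
      ultimately show ?thesis by auto
    qed
  qed
  have V: "V = (\<lambda>x. marginal U ?L x * F x)"
  proof
    fix x
    show "V x = marginal U ?L x * F x"
    proof (cases "\<forall>j. 0 < x j")
      case True
      then have "marginal U G x powr sub_index \<theta> U (\<lambda>j. 1 / x j) = marginal U ?L x"
        by (intro marginal_powr_sub_index[OF G L \<theta>_range]) auto
      with True show ?thesis by (simp add: V_def pmax_V_def U_def[symmetric] F_eq)
    next
      case False
      then obtain j where j: "\<not> 0 < x j" by blast
      have "marginal U ?L x = 0 \<or> F x = 0"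
      proof (cases "j \<in> U")
        case True
        have "marginal U ?L x = 0"
          by (rule vanish[OF LU True]) (rule j)
        then show ?thesis ..
      next
        case False
        have "F x = 0"
          by (rule vanish[OF F]) (use False j in auto)
        then show ?thesis ..
      qed
      moreover have "V x = 0"
        unfolding V_def pmax_V_def using False by (rule if_not_P)
      ultimately show ?thesis by auto
    qed
  qed
  note Vhat_mev = frechet_mev_mult[OF GU F, folded Vhat] and V_mev = frechet_mev_mult[OF LU F, folded V]
  have F1: "F x = marginal (- U) H ?one" if "\<And>i. i \<notin> U \<Longrightarrow> x i = 1" for x
    unfolding F_def by (rule marginal_cong) (simp add: that)
  have H_coeff: "extremal_coefficient (- U) (marginal (- U) H) = - ln (marginal (- U) H ?one)"
    and H_pos: "0 < marginal (- U) H ?one"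
    using extremal_coefficient_frechet_mev[OF HU] frechet_mev_pos[OF HU, of ?one] by simp_all
  have "extremal_coefficient UNIV Vhat = - ln (Vhat ?one)"
    using extremal_coefficient_frechet_mev[OF Vhat_mev] by simp
  also have "\<dots> = - ln (marginal U G ?one) - ln (marginal (- U) H ?one)"
    using frechet_mev_pos[OF GU, of ?one] H_pos by (simp add: Vhat F1 ln_mult)
  also have "\<dots> = extremal_coefficient U (marginal U G) + extremal_coefficient (- U) (marginal (- U) H)"
    using extremal_coefficient_frechet_mev[OF GU] by (simp add: H_coeff)
  finally have Vhat_coeff: "extremal_coefficient UNIV Vhat
    = extremal_coefficient U (marginal U G) + extremal_coefficient (- U) (marginal (- U) H)" .

  \<comment> \<open>the point at which all marginals of \<open>V\<close> take the value \<open>exp (- 1)\<close>\<close>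
  define y where "y i = (if i \<in> U then \<theta>m i else 1)" for i
  have y_pos: "0 < y i" for i by (simp add: y_def \<theta>m_pos)
  have scale: "(\<lambda>i. (if i \<in> U then \<theta>m i else 1) powr (1 / (if i \<in> U then 1 else 1 * \<alpha> i))) = y"
    using \<theta>m_pos by (auto simp: y_def less_imp_le)
  have G_copula: "copula_of U (marginal U G) (\<lambda>j. exp (- 1 / \<theta>m j)) = marginal U G y"
  proof -
    have C: "is_copula U (copula_of U (marginal U G))"
      and sklar: "marginal U G y = copula_of U (marginal U G) (\<lambda>i. marginal {i} (marginal U G) y)"
      using frechet_mev_copula[OF GU] by (auto simp: is_copula_of_def)
    have C_cong: "copula_of U (marginal U G) u = copula_of U (marginal U G) v" if "\<forall>i\<in>U. u i = v i" for u v
      using C that unfolding is_copula_def by blast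
    have "\<forall>i\<in>U. exp (- 1 / \<theta>m i) = marginal {i} (marginal U G) y"
      using frechet_mevD(4)[OF GU] \<theta>m_pos by (simp add: y_def frechet_unit unit_frechet_def)
    then have "copula_of U (marginal U G) (\<lambda>j. exp (- 1 / \<theta>m j))
        = copula_of U (marginal U G) (\<lambda>i. marginal {i} (marginal U G) y)"
      by (rule C_cong)
    with sklar show ?thesis by simp
  qed
  have index_y: "sub_index \<theta> U (\<lambda>j. 1 / y j) = sub_index \<theta> U (\<lambda>j. 1 / \<theta>m j)"
  proof -
    have "(\<lambda>j. if j \<in> U then 1 / y j else s j) = (\<lambda>j. if j \<in> U then 1 / \<theta>m j else s j)" for s
      by (auto simp: y_def)
    then show ?thesis by (simp add: sub_index_def)
  qed
  have F_y: "F y = marginal (- U) H ?one"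
    by (rule F1) (simp add: y_def)
  have "extremal_coefficient UNIV V = - ln (V y)"
    using extremal_coefficient_frechet_mev[OF V_mev] by (simp only: scale)
  also have "\<dots> = - ln (marginal U ?L y) - ln (marginal (- U) H ?one)"
    using frechet_mev_pos[OF LU, where x = y] y_pos H_pos F_y by (simp add: V ln_mult)
  also have "marginal U ?L y = marginal U G y powr sub_index \<theta> U (\<lambda>j. 1 / y j)"
    by (rule marginal_powr_sub_index[OF G L \<theta>_range y_pos, symmetric])
  also have "ln \<dots> = sub_index \<theta> U (\<lambda>j. 1 / \<theta>m j) * ln (marginal U G y)"
    using frechet_mev_pos[OF GU, of y] y_pos by (simp add: ln_powr index_y)
  finally have V_coeff: "extremal_coefficient UNIV V
    = sub_index \<theta> U (\<lambda>j. 1 / \<theta>m j) * (- ln (copula_of U (marginal U G) (\<lambda>j. exp (- 1 / \<theta>m j))))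
      + extremal_coefficient (- U) (marginal (- U) H)"
    unfolding G_copula by (simp add: H_coeff)
  show ?thesis
    by (intro conjI frechet_mev_imp_mev[OF Vhat_mev] frechet_mev_imp_mev[OF V_mev] Vhat_coeff V_coeff)
qed

end
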